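(* Let $1\le p<\infty$. Then for $0<\varepsilon<\frac12$, $\theta=\frac{\varepsilon}{1-\varepsilon}$ and $g\in\mathcal G_{p,\varphi^{X_T}_{C,\theta}}$ we have for the Euler scheme that $$\mathbb E|g(X_T)-g(X_T^E)|^p\le 3\cdot2^p\,(\sup f_{X_T})^{1-2\varepsilon}\,\Big(V_{p,\varphi^{X_T}_{C,\theta}}(g)\Big)^p\,C_{1/\theta}^{1-2\varepsilon}\,|\pi|^{\frac12-\varepsilon},$$ and similarly, for $0<\varepsilon<1$, $\theta=\frac{\varepsilon}{2-\varepsilon}$ and $g\in\mathcal G_{p,\varphi^{X_T}_{C,\theta}}$, we have for the Milstein scheme that $$\mathbb E|g(X_T)-g(X_T^M)|^p\le 3\cdot2^p\,(\sup f_{X_T})^{1-\varepsilon}\,\Big(V_{p,\varphi^{X_T}_{C,\theta}}(g)\Big)^p\,C_{1/\theta}^{1-\varepsilon}\,|\pi|^{1-\varepsilon}.$$ Here $C=(C_r)_{r\in[1,\infty)}$ denotes the constants, not depending on $\pi$, in the strong error bound of the scheme in question: $\|X_T-X_T^E\|_r\le C_r|\pi|^{1/2}$ for the Euler scheme and $\|X_T-X_T^M\|_r\le C_r|\pi|$ for the Milstein scheme, for all $r\in[1,\infty)$. Especially, the statements hold for any polynomial $g:\mathbb R\to\mathbb R$.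
   Context: Fix $T>0$ and a standard one-dimensional Brownian motion $W$ on a complete filtered probability space, the filtration being the augmentation of the natural filtration of $W$. $X$ is the unique adapted strong solution of $dX_t=\sigma(t,X_t)\,dW_t+b(t,X_t)\,dt$, $X_0=x_0\in\mathbb R$, on $[0,T]$, where $\sigma,b\in C^{0,1}([0,T]\times\mathbb R)$ and there are constants $C_T$ and $\alpha\ge\frac12$ such that for $f\in\{\sigma,b\}$: (i) $|f(t,x)|\le C_T(1+|x|)$; (ii) $|f(t,x)-f(t,y)|\le C_T|x-y|$; (iii) $|f(t,x)-f(s,x)|\le C_T(1+|x|)|t-s|^\alpha$. For the Milstein scheme it is assumed in addition that (iv) $\frac{\partial\sigma}{\partial x}$ and $\frac{\partial b}{\partial x}$ satisfy condition (ii). Moreover, (v) $X_T$ has a bounded density $f_{X_T}$. A partition $\pi$ of $[0,T]$ is $0=t_0<t_1<\dots<t_n=T$, with mesh size $|\pi|=\max_{0\le i<n}|t_{i+1}-t_i|$. The Euler scheme $X^E$ relative to $\pi$: $X^E_0=x_0$ and $X^E_{t_{i+1}}=X^E_{t_i}+b(t_i,X^E_{t_i})(t_{i+1}-t_i)+\sigma(t_i,X^E_{t_i})(W_{t_{i+1}}-W_{t_i})$ for $i=0,\dots,n-1$. The Milstein scheme $X^M$ relative to $\pi$: $X^M_0=x_0$ and $X^M_{t_{i+1}}=X^M_{t_i}+b(t_i,X^M_{t_i})(t_{i+1}-t_i)+\sigma(t_i,X^M_{t_i})(W_{t_{i+1}}-W_{t_i})+\frac12\sigma(t_i,X^M_{t_i})\sigma'_x(t_i,X^M_{t_i})\big((W_{t_{i+1}}-W_{t_i})^2-(t_{i+1}-t_i)\big)$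 for $i=0,\dots,n-1$. $\|Z\|_r=(\mathbb E|Z|^r)^{1/r}$. Strong error constants $C_r$ as in the claim are known to exist for both schemes. Bump function: $\varphi:\mathbb R\to\mathbb R$ with $0<\varphi(z)\le1$ for all $z$, $\varphi$ increasing (not necessarily strictly) in $(-\infty,0]$ and decreasing (not necessarily strictly) in $(0,\infty)$, and $\lim_{|z|\to\infty}\varphi(z)=0$. The function $\varphi^{X_T}_{C,\theta}$, for $0<\theta<1$ and a family $C=(C_r)_{r\in[1,\infty)}$: put $\varphi^{0}(\lambda)=\min\big\{1,\inf_{r\in[1,\infty)}\frac{(C_r+\|X_T\|_r)^{\theta r}}{|\lambda|^{\theta r}}\big\}$ for $\lambda\ne0$ and $\varphi^{0}(0)=1$ (here $X_T\in L_r$ for all $r\in[1,\infty)$), and $\varphi^{X_T}_{C,\theta}=\max\{\varphi^{0},\psi\}$, where $\psi$ is a bump function chosen to decay faster than any polynomial (for instance $\psi(\lambda)=e^{-|\lambda|}$), so that $\varphi^{X_T}_{C,\theta}$ is a bump function that decays faster than any polynomial. Class $\mathcal G_{p,\varphi}$ ($p\in[1,\infty)$, $\varphi$ a bump function): let $\mathcal M$ be the set of all signed measures $\mu$ on the Borel sets of $\mathbb R$ such that $|\mu|$ is $\sigma$-finite, and let $\mathcal M_{p,\varphi}=\{\mu\in\mathcal M:\varphi\in L_1^{loc}(\mathbb R,|\mu|)\cap L_{1+\frac1p}(\mathbb R,|\mu|)\}$. For $\mu\in\mathcal M_{p,\varphi}$ put $g^\mu(x)=\int_{(0,x]}\varphi\,d\mu$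 for $x\ge0$ and $g^\mu(x)=\int_{(x,0]}\varphi\,d\mu$ for $x<0$, with $(0,0]=\emptyset$. Let $\Delta_{p,\varphi}$ be the set of functions $\Delta_A(x)=\sum_{i=1}^\infty\lambda_i\varphi(a_i)\chi_{\{a_i\}}(x)$ with $A=(a_i)_{i=1}^\infty\subset\mathbb R$ countable, $a_i\ne a_j$ if $i\ne j$, $(\lambda_i)_{i=1}^\infty\subset\mathbb R$ and $\sum_{i=1}^\infty|\lambda_i|\varphi(a_i)^{1+\frac1p}<\infty$, where $\chi$ denotes indicator functions. Then $\mathcal G_{p,\varphi}$ is the set of all $g=c+g^\mu+\Delta_A$ with $c\in\mathbb R$, $\mu\in\mathcal M_{p,\varphi}$ and $\Delta_A\in\Delta_{p,\varphi}$ (this decomposition is unique), and $V_{p,\varphi}(g)=\int_{\mathbb R}\varphi^{1+\frac1p}\,d|\mu|+\sum_{i=1}^\infty|\lambda_i|\varphi(a_i)^{1+\frac1p}$.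
   Formalization: The bounds are proved for partitions with mesh |π| ≤ 1, or for coarser ones when also ‖X_T − X_T^scheme‖_r ≤ C_r for all r ≥ 1; without this the claim fails (e.g. b=0, σ=max(0,1−t), T large, one-step partition, g the indicator of [z,∞)). *)

theory Defs
  imports "HOL-Probability.Probability" "HOL-Computational_Algebra.Polynomial"
begin

section \<open>Brownian motion, Ito integral and strong solutions on \<open>[0,T]\<close>\<close>

definition brownian_motion_on :: "'a measure \<Rightarrow> real \<Rightarrow> (real \<Rightarrow> 'a \<Rightarrow> real) \<Rightarrow> bool" where
  "brownian_motion_on M T W \<longleftrightarrow>
     (\<forall>t\<in>{0..T}. W t \<in> borel_measurable M) \<and>
     (AE \<omega> in M. W 0 \<omega> = 0) \<and>
     (AE \<omega> in M. continuous_on {0..T} (\<lambda>t. W t \<omega>)) \<and>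
     (\<forall>s t. 0 \<le> s \<longrightarrow> s < t \<longrightarrow> t \<le> T \<longrightarrow>
        distributed M lborel (\<lambda>\<omega>. W t \<omega> - W s \<omega>) (normal_density 0 (sqrt (t - s)))) \<and>
     (\<forall>n (s :: nat \<Rightarrow> real). 0 \<le> s 0 \<longrightarrow> (\<forall>i<n. s i < s (Suc i)) \<longrightarrow> s n \<le> T \<longrightarrow>
        prob_space.indep_vars M (\<lambda>_. borel) (\<lambda>i \<omega>. W (s (Suc i)) \<omega> - W (s i) \<omega>) {..<n})"

definition augmented_filtration :: "'a measure \<Rightarrow> (real \<Rightarrow> 'a \<Rightarrow> real) \<Rightarrow> real \<Rightarrow> 'a measure" where
  "augmented_filtration M W t =
     sigma (space M) ({W s -` B \<inter> space M | s B. 0 \<le> s \<and> s \<le> t \<and> B \<in> sets borel} \<union> null_sets M)"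

definition adapted_on :: "(real \<Rightarrow> 'a measure) \<Rightarrow> real \<Rightarrow> (real \<Rightarrow> 'a \<Rightarrow> real) \<Rightarrow> bool" where
  "adapted_on F T X \<longleftrightarrow> (\<forall>t\<in>{0..T}. X t \<in> borel_measurable (F t))"

definition progressive_on :: "(real \<Rightarrow> 'a measure) \<Rightarrow> real \<Rightarrow> (real \<Rightarrow> 'a \<Rightarrow> real) \<Rightarrow> bool" where
  "progressive_on F T H \<longleftrightarrow>
     (\<forall>t\<in>{0..T}. (\<lambda>(s, \<omega>). H s \<omega>) \<in> borel_measurable (restrict_space borel {0..t} \<Otimes>\<^sub>M F t))"

text \<open>A triple \<open>(n, s, \<xi>)\<close> stands for the elementary process that equals \<open>\<xi> i\<close> on the interval
  from \<open>s i\<close> (excluded) to \<open>s (Suc i)\<close> (included), \<open>i < n\<close>, and is zero elsewhere.\<close>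

type_synonym 'a elementary = "nat \<times> (nat \<Rightarrow> real) \<times> (nat \<Rightarrow> 'a \<Rightarrow> real)"

fun is_elementary :: "(real \<Rightarrow> 'a measure) \<Rightarrow> real \<Rightarrow> 'a elementary \<Rightarrow> bool" where
  "is_elementary F T (n, s, \<xi>) \<longleftrightarrow>
     0 \<le> s 0 \<and> (\<forall>i<n. s i < s (Suc i)) \<and> s n \<le> T \<and>
     (\<forall>i<n. \<xi> i \<in> borel_measurable (F (s i)) \<and> (\<exists>K. \<forall>\<omega>\<in>space (F (s i)). \<bar>\<xi> i \<omega>\<bar> \<le> K))"

fun elementary_process :: "'a elementary \<Rightarrow> real \<Rightarrow> 'a \<Rightarrow> real" where
  "elementary_process (n, s, \<xi>) t \<omega> = (\<Sum>i<n. \<xi> i \<omega> * indicator {s i<..s (Suc i)} t)"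

fun elementary_integral :: "(real \<Rightarrow> 'a \<Rightarrow> real) \<Rightarrow> 'a elementary \<Rightarrow> real \<Rightarrow> 'a \<Rightarrow> real" where
  "elementary_integral W (n, s, \<xi>) t \<omega> =
     (\<Sum>i<n. \<xi> i \<omega> * (W (min (s (Suc i)) t) \<omega> - W (min (s i) t) \<omega>))"

text \<open>\<open>I\<close> is (a version of) the Ito integral process of \<open>H\<close>: for progressive integrands with
  square integrable paths it is the limit in probability of the integrals of any elementary
  processes that converge to \<open>H\<close> in probability with respect to the \<open>L\<^sub>2([0,T])\<close> norm.\<close>

definition is_ito_integral ::
  "'a measure \<Rightarrow> (real \<Rightarrow> 'a measure) \<Rightarrow> real \<Rightarrow> (real \<Rightarrow> 'a \<Rightarrow> real) \<Rightarrow>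
   (real \<Rightarrow> 'a \<Rightarrow> real) \<Rightarrow> (real \<Rightarrow> 'a \<Rightarrow> real) \<Rightarrow> bool" where
  "is_ito_integral M F T W H I \<longleftrightarrow>
     progressive_on F T H \<and>
     (AE \<omega> in M. (\<integral>\<^sup>+ t\<in>{0..T}. ennreal ((H t \<omega>)\<^sup>2) \<partial>lborel) < \<infinity>) \<and>
     adapted_on F T I \<and>
     (\<exists>E. (\<forall>k::nat. is_elementary F T (E k)) \<and>
        (\<forall>\<delta>>0. (\<lambda>k. measure M {\<omega> \<in> space M.
             (\<integral>\<^sup>+ t\<in>{0..T}. ennreal ((elementary_process (E k) t \<omega> - H t \<omega>)\<^sup>2) \<partial>lborel) > ennreal \<delta>})
           \<longlonglongrightarrow> 0) \<and>
        (\<forall>t\<in>{0..T}. \<forall>\<delta>>0. (\<lambda>k. measure M {\<omega> \<in> space M.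
             \<bar>elementary_integral W (E k) t \<omega> - I t \<omega>\<bar> > \<delta>}) \<longlonglongrightarrow> 0))"

definition strong_solution ::
  "'a measure \<Rightarrow> real \<Rightarrow> (real \<Rightarrow> 'a \<Rightarrow> real) \<Rightarrow> (real \<Rightarrow> real \<Rightarrow> real) \<Rightarrow> (real \<Rightarrow> real \<Rightarrow> real) \<Rightarrow>
   real \<Rightarrow> (real \<Rightarrow> 'a \<Rightarrow> real) \<Rightarrow> bool" where
  "strong_solution M T W \<sigma> b x0 X \<longleftrightarrow>
     adapted_on (augmented_filtration M W) T X \<and>
     (AE \<omega> in M. continuous_on {0..T} (\<lambda>t. X t \<omega>)) \<and>
     (\<exists>I. is_ito_integral M (augmented_filtration M W) T W (\<lambda>t \<omega>. \<sigma> t (X t \<omega>)) I \<and>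
        (\<forall>t\<in>{0..T}. AE \<omega> in M.
           X t \<omega> = x0 + I t \<omega> + (LINT s:{0..t}|lborel. b s (X s \<omega>))))"


section \<open>Coefficients and schemes\<close>

text \<open>\<open>C\<^sup>0\<^sup>,\<^sup>1\<close>: jointly continuous, with a jointly continuous derivative in the space variable.\<close>

definition C01_on :: "real \<Rightarrow> (real \<Rightarrow> real \<Rightarrow> real) \<Rightarrow> bool" where
  "C01_on T f \<longleftrightarrow>
     continuous_on ({0..T} \<times> UNIV) (\<lambda>(t, x). f t x) \<and>
     (\<forall>t\<in>{0..T}. \<forall>x. f t field_differentiable at x) \<and>
     continuous_on ({0..T} \<times> UNIV) (\<lambda>(t, x). deriv (f t) x)"

definition space_lipschitz :: "real \<Rightarrow> real \<Rightarrow> (real \<Rightarrow> real \<Rightarrow> real) \<Rightarrow> bool" where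
  "space_lipschitz T K f \<longleftrightarrow> (\<forall>t\<in>{0..T}. \<forall>x y. \<bar>f t x - f t y\<bar> \<le> K * \<bar>x - y\<bar>)"

definition admissible_coeff :: "real \<Rightarrow> real \<Rightarrow> real \<Rightarrow> (real \<Rightarrow> real \<Rightarrow> real) \<Rightarrow> bool" where
  "admissible_coeff T K \<alpha> f \<longleftrightarrow>
     C01_on T f \<and>
     (\<forall>t\<in>{0..T}. \<forall>x. \<bar>f t x\<bar> \<le> K * (1 + \<bar>x\<bar>)) \<and>
     space_lipschitz T K f \<and>
     (\<forall>s\<in>{0..T}. \<forall>t\<in>{0..T}. \<forall>x. \<bar>f t x - f s x\<bar> \<le> K * (1 + \<bar>x\<bar>) * \<bar>t - s\<bar> powr \<alpha>)"

definition time_grid :: "real \<Rightarrow> nat \<Rightarrow> (nat \<Rightarrow> real) \<Rightarrow> bool" where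
  "time_grid T n \<tau> \<longleftrightarrow> \<tau> 0 = 0 \<and> \<tau> n = T \<and> (\<forall>i<n. \<tau> i < \<tau> (Suc i))"

definition mesh :: "nat \<Rightarrow> (nat \<Rightarrow> real) \<Rightarrow> real" where
  "mesh n \<tau> = (MAX i\<in>{..<n}. \<bar>\<tau> (Suc i) - \<tau> i\<bar>)"

primrec euler_scheme ::
  "(real \<Rightarrow> real \<Rightarrow> real) \<Rightarrow> (real \<Rightarrow> real \<Rightarrow> real) \<Rightarrow> real \<Rightarrow> (real \<Rightarrow> 'a \<Rightarrow> real) \<Rightarrow>
   (nat \<Rightarrow> real) \<Rightarrow> nat \<Rightarrow> 'a \<Rightarrow> real" where
  "euler_scheme \<sigma> b x0 W \<tau> 0 \<omega> = x0"
| "euler_scheme \<sigma> b x0 W \<tau> (Suc i) \<omega> =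
     (let x = euler_scheme \<sigma> b x0 W \<tau> i \<omega> in
      x + b (\<tau> i) x * (\<tau> (Suc i) - \<tau> i) + \<sigma> (\<tau> i) x * (W (\<tau> (Suc i)) \<omega> - W (\<tau> i) \<omega>))"

primrec milstein_scheme ::
  "(real \<Rightarrow> real \<Rightarrow> real) \<Rightarrow> (real \<Rightarrow> real \<Rightarrow> real) \<Rightarrow> real \<Rightarrow> (real \<Rightarrow> 'a \<Rightarrow> real) \<Rightarrow>
   (nat \<Rightarrow> real) \<Rightarrow> nat \<Rightarrow> 'a \<Rightarrow> real" where
  "milstein_scheme \<sigma> b x0 W \<tau> 0 \<omega> = x0"
| "milstein_scheme \<sigma> b x0 W \<tau> (Suc i) \<omega> =
     (let x = milstein_scheme \<sigma> b x0 W \<tau> i \<omega> in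
      x + b (\<tau> i) x * (\<tau> (Suc i) - \<tau> i) + \<sigma> (\<tau> i) x * (W (\<tau> (Suc i)) \<omega> - W (\<tau> i) \<omega>)
        + 1/2 * \<sigma> (\<tau> i) x * deriv (\<sigma> (\<tau> i)) x
          * ((W (\<tau> (Suc i)) \<omega> - W (\<tau> i) \<omega>)\<^sup>2 - (\<tau> (Suc i) - \<tau> i)))"

definition Lr_norm :: "'a measure \<Rightarrow> real \<Rightarrow> ('a \<Rightarrow> real) \<Rightarrow> real" where
  "Lr_norm M r Z = (\<integral>\<omega>. \<bar>Z \<omega>\<bar> powr r \<partial>M) powr (1 / r)"

text \<open>\<open>Y \<tau> n\<close> is the terminal value of the scheme on the grid \<open>\<tau> 0, \<dots>, \<tau> n\<close>. Integrability is
  stated explicitly, because the Bochner integral of a non-integrable function is zero.\<close>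

definition strong_error_constants ::
  "'a measure \<Rightarrow> real \<Rightarrow> ('a \<Rightarrow> real) \<Rightarrow> ((nat \<Rightarrow> real) \<Rightarrow> nat \<Rightarrow> 'a \<Rightarrow> real) \<Rightarrow> real \<Rightarrow>
   (real \<Rightarrow> real) \<Rightarrow> bool" where
  "strong_error_constants M T Z Y \<gamma> C \<longleftrightarrow>
     (\<forall>n \<tau>. time_grid T n \<tau> \<longrightarrow> (\<forall>r\<ge>1.
        integrable M (\<lambda>\<omega>. \<bar>Z \<omega> - Y \<tau> n \<omega>\<bar> powr r) \<and>
        Lr_norm M r (\<lambda>\<omega>. Z \<omega> - Y \<tau> n \<omega>) \<le> C r * mesh n \<tau> powr \<gamma>))"


section \<open>Bump functions\<close>

definition bump :: "(real \<Rightarrow> real) \<Rightarrow> bool" where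
  "bump \<phi> \<longleftrightarrow> (\<forall>z. 0 < \<phi> z \<and> \<phi> z \<le> 1) \<and> mono_on {..0} \<phi> \<and> antimono_on {0<..} \<phi> \<and>
     (\<phi> \<longlongrightarrow> 0) at_infinity"

definition rapidly_decaying :: "(real \<Rightarrow> real) \<Rightarrow> bool" where
  "rapidly_decaying \<phi> \<longleftrightarrow> (\<forall>k::nat. ((\<lambda>z. \<bar>z\<bar> ^ k * \<phi> z) \<longlongrightarrow> 0) at_infinity)"

definition tail_bump0 :: "'a measure \<Rightarrow> ('a \<Rightarrow> real) \<Rightarrow> (real \<Rightarrow> real) \<Rightarrow> real \<Rightarrow> real \<Rightarrow> real" where
  "tail_bump0 M Z C \<theta> z =
     (if z = 0 then 1
      else min 1 (INF r\<in>{1..}. (C r + Lr_norm M r Z) powr (\<theta> * r) / \<bar>z\<bar> powr (\<theta> * r)))"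

definition tail_bump ::
  "'a measure \<Rightarrow> ('a \<Rightarrow> real) \<Rightarrow> (real \<Rightarrow> real) \<Rightarrow> real \<Rightarrow> (real \<Rightarrow> real) \<Rightarrow> real \<Rightarrow> real" where
  "tail_bump M Z C \<theta> \<psi> z = max (tail_bump0 M Z C \<theta> z) (\<psi> z)"


section \<open>The class \<open>\<G>\<^sub>p\<^sub>,\<^sub>\<phi>\<close>\<close>

text \<open>A signed measure \<open>\<mu>\<close> is represented by its Jordan decomposition \<open>(\<mu>\<^sup>+, \<mu>\<^sup>-)\<close>. Both parts may
  have infinite mass (only the total variation has to be sigma-finite): this is needed for
  example for \<open>g x = x\<close>, where \<open>d\<mu> = sgn(x)/\<phi>(x) dx\<close>.\<close>

type_synonym signed_measure = "real measure \<times> real measure"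

definition total_variation :: "signed_measure \<Rightarrow> real measure" where
  "total_variation \<mu> =
     measure_of UNIV (sets borel) (\<lambda>A. emeasure (fst \<mu>) A + emeasure (snd \<mu>) A)"

definition signed_measures :: "signed_measure set" where
  "signed_measures = {\<mu>. sets (fst \<mu>) = sets borel \<and> sets (snd \<mu>) = sets borel \<and>
     (\<exists>S\<in>sets borel. emeasure (fst \<mu>) (- S) = 0 \<and> emeasure (snd \<mu>) S = 0) \<and>
     sigma_finite_measure (total_variation \<mu>)}"

definition signed_integral :: "signed_measure \<Rightarrow> real set \<Rightarrow> (real \<Rightarrow> real) \<Rightarrow> real" where
  "signed_integral \<mu> A f = (LINT x:A|fst \<mu>. f x) - (LINT x:A|snd \<mu>. f x)"

definition M_class :: "real \<Rightarrow> (real \<Rightarrow> real) \<Rightarrow> signed_measure set" where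
  "M_class p \<phi> = {\<mu> \<in> signed_measures.
     (\<forall>K. compact K \<longrightarrow> set_integrable (total_variation \<mu>) K \<phi>) \<and>
     integrable (total_variation \<mu>) (\<lambda>x. \<bar>\<phi> x\<bar> powr (1 + 1/p))}"

definition g_part :: "(real \<Rightarrow> real) \<Rightarrow> signed_measure \<Rightarrow> real \<Rightarrow> real" where
  "g_part \<phi> \<mu> x = (if x \<ge> 0 then signed_integral \<mu> {0<..x} \<phi> else signed_integral \<mu> {x<..0} \<phi>)"

definition Delta_part :: "(real \<Rightarrow> real) \<Rightarrow> (nat \<Rightarrow> real) \<Rightarrow> (nat \<Rightarrow> real) \<Rightarrow> real \<Rightarrow> real" where
  "Delta_part \<phi> a l x = (\<Sum>i. l i * \<phi> (a i) * indicator {a i} x)"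

definition decomposition ::
  "real \<Rightarrow> (real \<Rightarrow> real) \<Rightarrow> (real \<Rightarrow> real) \<Rightarrow> real \<Rightarrow> signed_measure \<Rightarrow> (nat \<Rightarrow> real) \<Rightarrow>
   (nat \<Rightarrow> real) \<Rightarrow> bool" where
  "decomposition p \<phi> g c \<mu> a l \<longleftrightarrow>
     \<mu> \<in> M_class p \<phi> \<and> inj a \<and> summable (\<lambda>i. \<bar>l i\<bar> * \<phi> (a i) powr (1 + 1/p)) \<and>
     (\<forall>x. g x = c + g_part \<phi> \<mu> x + Delta_part \<phi> a l x)"

definition G_class :: "real \<Rightarrow> (real \<Rightarrow> real) \<Rightarrow> (real \<Rightarrow> real) set" where
  "G_class p \<phi> = {g. \<exists>c \<mu> a l. decomposition p \<phi> g c \<mu> a l}"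

text \<open>For a bump function \<open>\<phi>\<close> the decomposition of \<open>g \<in> G_class p \<phi>\<close> is unique (up to terms of the
  series with \<open>l i = 0\<close> and its enumeration), so there is exactly one such value \<open>v\<close>.\<close>

definition V_functional :: "real \<Rightarrow> (real \<Rightarrow> real) \<Rightarrow> (real \<Rightarrow> real) \<Rightarrow> real" where
  "V_functional p \<phi> g = (SOME v. \<exists>c \<mu> a l. decomposition p \<phi> g c \<mu> a l \<and>
     v = (\<integral>x. \<phi> x powr (1 + 1/p) \<partial>total_variation \<mu>)
       + (\<Sum>i. \<bar>l i\<bar> * \<phi> (a i) powr (1 + 1/p)))"

end

theory Submission
  imports Defs
begin

text \<open>
  Write \<open>Y\<close> for the scheme at time \<open>T\<close> and \<open>H\<^sub>z\<close> for the event that \<open>z\<close> lies between \<open>X\<^sub>T\<close> and \<open>Y\<close>. On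
  \<open>H\<^sub>z\<close> either \<open>\<bar>X\<^sub>T - z\<bar> \<le> d\<close> or \<open>\<bar>X\<^sub>T - Y\<bar> > d\<close>; the bounded density, Markov's inequality and the best
  \<open>d\<close> give Avikainen's estimate of \<open>P(H\<^sub>z)\<close>, uniform in \<open>z\<close>. On the other hand \<open>H\<^sub>z\<close> forces
  \<open>max \<bar>X\<^sub>T\<bar> \<bar>Y\<bar> \<ge> \<bar>z\<bar>\<close>, so \<open>P(H\<^sub>z)\<close> decays like every moment allows. The geometric mean of both bounds
  with weights \<open>1 - \<theta>\<close> and \<open>\<theta>\<close> is \<open>P(H\<^sub>z) \<le> K \<phi>(z)\<close>, where \<open>K\<close> carries the rate. Since
  \<open>\<bar>g(X\<^sub>T) - g(Y)\<bar>\<close> is at most the integral of \<open>\<phi>(z) 1(H\<^sub>z)\<close> against \<open>\<bar>\<mu>\<bar>\<close> and the atoms of \<open>\<Delta>\<^sub>A\<close>,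
  Hoelder's inequality for the finite measure \<open>\<phi>\<^sup>1\<^sup>+\<^sup>1\<^sup>/\<^sup>p d\<bar>\<mu>\<bar>\<close> and Tonelli's theorem conclude. A polynomial
  \<open>q\<close> has the density \<open>sgn(x) q'(x) / \<phi>(x)\<close>, the sign accounting for the orientation of \<open>g\<^sup>\<mu>\<close> on the
  negative half line.
\<close>

subsection \<open>Crossing probabilities\<close>

lemma Lr_norm_nonneg: "0 \<le> Lr_norm M r Z"
  by (simp add: Lr_norm_def)

lemma integral_powr_le_of_Lr_norm_le:
  assumes "0 < r" "Lr_norm M r Z \<le> e"
  shows "(\<integral>\<omega>. \<bar>Z \<omega>\<bar> powr r \<partial>M) \<le> e powr r"
proof -
  let ?E = "\<integral>\<omega>. \<bar>Z \<omega>\<bar> powr r \<partial>M"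
  have "?E = (?E powr (1 / r)) powr r"
    using assms(1) by (simp add: powr_powr)
  also have "\<dots> \<le> e powr r"
    using assms by (intro powr_mono2) (auto simp: Lr_norm_def)
  finally show ?thesis .
qed

text \<open>Convexity of the power \<open>r\<close> at the points \<open>x / A\<close> and
  \<open>y / B\<close> with weights \<open>A / (A + B)\<close> and \<open>B / (A + B)\<close>. After
  integration, with \<open>A\<close> and \<open>B\<close> bounding the two norms, the bracket is at
  most 1, which is Minkowski's inequality.\<close>

lemma convex_powr_weighted:
  fixes x y A B r :: real
  assumes "1 \<le> r" "0 \<le> x" "0 \<le> y" "0 < A" "0 < B"
  shows "(x + y) powr r
    \<le> (A + B) powr r * (A / (A + B) * (x powr r / A powr r) + B / (A + B) * (y powr r / B powr r))"
proof -
  \<comment> \<open>Convexity is applied below to positive \<open>u\<close> and \<open>v\<close>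
    only; when one of them is zero, \<open>s powr r \<le> s\<close> does the work.\<close>
  have sub: "(s * u) powr r \<le> s * u powr r" if "0 \<le> s" "s \<le> 1" "0 \<le> u" for s u :: real
  proof (cases "s = 0")
    case False
    have "s powr r \<le> s powr 1"
      using False that assms by (intro powr_mono') auto
    then show ?thesis
      using that by (simp add: powr_mult mult_right_mono)
  qed simp
  have conv: "(s * u + (1 - s) * v) powr r \<le> s * u powr r + (1 - s) * v powr r"
    if s: "0 < s" "s < 1" and uv: "0 \<le> u" "0 \<le> v" for s u v :: real
  proof (cases "u = 0 \<or> v = 0")
    case True
    then show ?thesis using sub[of s u] sub[of "1 - s" v] s uv assms by auto
  next
    case False
    then show ?thesis
      using convex_onD[OF powr_convex[OF assms(1)], of "1 - s" u v] s uv by simp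
  qed
  let ?s = "A / (A + B)"
  have s: "0 < ?s" "?s < 1" "1 - ?s = B / (A + B)"
    using assms by (auto simp: field_simps)
  have "x + y = (A + B) * (?s * (x / A) + (1 - ?s) * (y / B))"
    unfolding s(3) using assms by (simp add: distrib_left)
  then have "(x + y) powr r = (A + B) powr r * (?s * (x / A) + (1 - ?s) * (y / B)) powr r"
    using assms s by (simp add: powr_mult)
  also have "\<dots> \<le> (A + B) powr r * (?s * (x / A) powr r + (1 - ?s) * (y / B) powr r)"
    using assms s by (intro mult_left_mono conv) auto
  finally show ?thesis
    using assms s(3) by (simp add: powr_divide)
qed

lemma integrable_abs_diff_powr:
  fixes X Y :: "'a \<Rightarrow> real"
  assumes [measurable]: "X \<in> borel_measurable M" "Y \<in> borel_measurable M"
    and "1 \<le> r"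
    and "integrable M (\<lambda>\<omega>. \<bar>X \<omega>\<bar> powr r)" "integrable M (\<lambda>\<omega>. \<bar>Y \<omega>\<bar> powr r)"
  shows "integrable M (\<lambda>\<omega>. \<bar>X \<omega> - Y \<omega>\<bar> powr r)"
proof (rule Bochner_Integration.integrable_bound)
  show "integrable M (\<lambda>\<omega>. 2 powr r * (1/2 * \<bar>X \<omega>\<bar> powr r + 1/2 * \<bar>Y \<omega>\<bar> powr r))"
    using assms by auto
  have "\<bar>X \<omega> - Y \<omega>\<bar> powr r \<le> (\<bar>X \<omega>\<bar> + \<bar>Y \<omega>\<bar>) powr r" for \<omega>
    using assms by (intro powr_mono2) auto
  also have "\<dots> \<omega> \<le> 2 powr r * (1/2 * \<bar>X \<omega>\<bar> powr r + 1/2 * \<bar>Y \<omega>\<bar> powr r)" for \<omega>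
    using convex_powr_weighted[of r "\<bar>X \<omega>\<bar>" "\<bar>Y \<omega>\<bar>" 1 1] assms by simp
  finally show "AE \<omega> in M. norm (\<bar>X \<omega> - Y \<omega>\<bar> powr r)
      \<le> norm (2 powr r * (1/2 * \<bar>X \<omega>\<bar> powr r + 1/2 * \<bar>Y \<omega>\<bar> powr r))"
    by auto
qed measurable

text \<open>Minkowski's inequality for \<open>Y = X - (X - Y)\<close>. Upper bounds \<open>A\<close>
  and \<open>B\<close> stand in for the norms because the proof divides by them, and a norm may
  vanish.\<close>

lemma integral_sum_powr_le:
  fixes X Y :: "'a \<Rightarrow> real"
  assumes [measurable]: "X \<in> borel_measurable M" "Y \<in> borel_measurable M"
    and r: "1 \<le> r"
    and int: "integrable M (\<lambda>\<omega>. \<bar>X \<omega>\<bar> powr r)" "integrable M (\<lambda>\<omega>. \<bar>X \<omega> - Y \<omega>\<bar> powr r)"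
    and AB: "0 < A" "0 < B"
    and le: "Lr_norm M r X \<le> A" "Lr_norm M r (\<lambda>\<omega>. X \<omega> - Y \<omega>) \<le> B"
  shows "integrable M (\<lambda>\<omega>. \<bar>Y \<omega>\<bar> powr r)"
    and "(\<integral>\<omega>. \<bar>Y \<omega>\<bar> powr r \<partial>M) \<le> (A + B) powr r"
proof -
  show iY: "integrable M (\<lambda>\<omega>. \<bar>Y \<omega>\<bar> powr r)"
    using integrable_abs_diff_powr[of X M "\<lambda>\<omega>. X \<omega> - Y \<omega>" r] r int by simp
  have pt: "\<bar>Y \<omega>\<bar> powr r \<le> (A + B) powr r *
      (A / (A + B) * (\<bar>X \<omega>\<bar> powr r / A powr r) + B / (A + B) * (\<bar>X \<omega> - Y \<omega>\<bar> powr r / B powr r))" for \<omega>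
  proof -
    have "\<bar>Y \<omega>\<bar> powr r \<le> (\<bar>X \<omega>\<bar> + \<bar>X \<omega> - Y \<omega>\<bar>) powr r"
      using r by (intro powr_mono2) auto
    then show ?thesis
      using convex_powr_weighted[of r "\<bar>X \<omega>\<bar>" "\<bar>X \<omega> - Y \<omega>\<bar>" A B] r AB by simp
  qed
  have "(\<integral>\<omega>. \<bar>Y \<omega>\<bar> powr r \<partial>M) \<le> (\<integral>\<omega>. (A + B) powr r *
      (A / (A + B) * (\<bar>X \<omega>\<bar> powr r / A powr r) + B / (A + B) * (\<bar>X \<omega> - Y \<omega>\<bar> powr r / B powr r)) \<partial>M)"
    using iY int pt by (intro integral_mono) auto
  also have "\<dots> = (A + B) powr r * (A / (A + B) * ((\<integral>\<omega>. \<bar>X \<omega>\<bar> powr r \<partial>M) / A powr r)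
      + B / (A + B) * ((\<integral>\<omega>. \<bar>X \<omega> - Y \<omega>\<bar> powr r \<partial>M) / B powr r))"
    using int by simp
  also have "\<dots> \<le> (A + B) powr r * (A / (A + B) * 1 + B / (A + B) * 1)"
    using AB r integral_powr_le_of_Lr_norm_le[OF _ le(1)] integral_powr_le_of_Lr_norm_le[OF _ le(2)]
    by (intro mult_left_mono add_mono) auto
  also have "\<dots> = (A + B) powr r"
    using AB by (simp flip: add_divide_distrib)
  finally show "(\<integral>\<omega>. \<bar>Y \<omega>\<bar> powr r \<partial>M) \<le> (A + B) powr r" .
qed

lemma (in prob_space) prob_abs_ge_le:
  fixes X :: "'a \<Rightarrow> real"
  assumes "integrable M (\<lambda>\<omega>. \<bar>X \<omega>\<bar> powr r)" "0 < d" "0 < r"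
  shows "prob {\<omega> \<in> space M. d powr r \<le> \<bar>X \<omega>\<bar> powr r} \<le> (\<integral>\<omega>. \<bar>X \<omega>\<bar> powr r \<partial>M) / d powr r"
  by (rule integral_Markov_inequality_measure[where A="{}"]) (use assms in auto)

text \<open>The event \<open>H\<^sub>z\<close>. Both ends are included, so that an atom of
  \<open>g\<close> located exactly at \<open>X\<close> or at \<open>Y\<close> is counted.\<close>

definition between_event :: "'a measure \<Rightarrow> ('a \<Rightarrow> real) \<Rightarrow> ('a \<Rightarrow> real) \<Rightarrow> real \<Rightarrow> 'a set" where
  "between_event M X Y z = {\<omega> \<in> space M. min (X \<omega>) (Y \<omega>) \<le> z \<and> z \<le> max (X \<omega>) (Y \<omega>)}"

lemma between_event_sets [measurable]:
  assumes [measurable]: "X \<in> borel_measurable M" "Y \<in> borel_measurable M"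
  shows "between_event M X Y z \<in> sets M"
  unfolding between_event_def by measurable

lemma (in prob_space) prob_near_le:
  fixes f :: "real \<Rightarrow> real"
  assumes X: "distributed M lborel X f" and f: "\<And>x. 0 \<le> f x" "\<And>x. f x \<le> D" and "0 \<le> d"
  shows "prob {\<omega> \<in> space M. \<bar>X \<omega> - z\<bar> \<le> d} \<le> 2 * D * d"
proof -
  have D: "0 \<le> D" using f[of 0] by simp
  have "{\<omega> \<in> space M. \<bar>X \<omega> - z\<bar> \<le> d} = X -` {z-d..z+d} \<inter> space M" by auto
  then have "emeasure M {\<omega> \<in> space M. \<bar>X \<omega> - z\<bar> \<le> d} = (\<integral>\<^sup>+x. ennreal (f x) * indicator {z-d..z+d} x \<partial>lborel)"
    using distributed_emeasure[OF X, of "{z-d..z+d}"] by simp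
  also have "\<dots> \<le> (\<integral>\<^sup>+x. ennreal D * indicator {z-d..z+d} x \<partial>lborel)"
    using f D by (intro nn_integral_mono mult_right_mono) (auto intro: ennreal_leI)
  also have "\<dots> = ennreal (2 * D * d)"
    using \<open>0 \<le> d\<close> D by (subst nn_integral_cmult_indicator) (auto simp: ennreal_mult[symmetric] mult_ac)
  finally show ?thesis
    using D \<open>0 \<le> d\<close> by (simp add: emeasure_eq_measure)
qed

text \<open>A density bounded by zero would have total mass zero. Positivity of \<open>D\<close>
  permits the choices of \<open>d\<close> below that divide by it.\<close>

lemma (in prob_space) density_bound_pos:
  fixes f :: "real \<Rightarrow> real"
  assumes X: "distributed M lborel X f" and f: "\<And>x. 0 \<le> f x" "\<And>x. f x \<le> D"
  shows "0 < D"
proof (rule ccontr)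
  assume "\<not> 0 < D"
  then have "f x = 0" for x using f[of x] by (auto intro!: antisym)
  then have "emeasure M (X -` UNIV \<inter> space M) = 0"
    using distributed_emeasure[OF X, of UNIV] by simp
  then show False using emeasure_space_1 by simp
qed

lemma (in prob_space) prob_between_le_split:
  fixes f :: "real \<Rightarrow> real"
  assumes X: "distributed M lborel X f" and f: "\<And>x. 0 \<le> f x" "\<And>x. f x \<le> D"
    and [measurable]: "X \<in> borel_measurable M" "Y \<in> borel_measurable M"
    and r: "0 < r" and int: "integrable M (\<lambda>\<omega>. \<bar>X \<omega> - Y \<omega>\<bar> powr r)"
    and e: "Lr_norm M r (\<lambda>\<omega>. X \<omega> - Y \<omega>) \<le> e" and d: "0 < d"
  shows "prob (between_event M X Y z) \<le> 2 * D * d + e powr r / d powr r"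
proof -
  let ?A = "{\<omega> \<in> space M. \<bar>X \<omega> - z\<bar> \<le> d}" and ?B = "{\<omega> \<in> space M. d powr r \<le> \<bar>X \<omega> - Y \<omega>\<bar> powr r}"
  \<comment> \<open>If \<open>z\<close> lies between \<open>X\<close> and \<open>Y\<close>, then
    \<open>\<bar>X - z\<bar> \<le> \<bar>X - Y\<bar>\<close>, so leaving \<open>?A\<close> forces
    \<open>d < \<bar>X - Y\<bar>\<close>.\<close>
  have "between_event M X Y z \<subseteq> ?A \<union> ?B"
    using r d by (auto simp: between_event_def intro!: powr_mono2)
  then have "prob (between_event M X Y z) \<le> prob (?A \<union> ?B)"
    by (intro finite_measure_mono) auto
  also have "\<dots> \<le> prob ?A + prob ?B"
    by (intro measure_Un_le) auto
  also have "\<dots> \<le> 2 * D * d + (\<integral>\<omega>. \<bar>X \<omega> - Y \<omega>\<bar> powr r \<partial>M) / d powr r"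
    using r d by (intro add_mono prob_near_le[OF X f] prob_abs_ge_le int) auto
  also have "\<dots> \<le> 2 * D * d + e powr r / d powr r"
    using integral_powr_le_of_Lr_norm_le[OF r e] by (intro add_left_mono divide_right_mono) auto
  finally show ?thesis .
qed

text \<open>For \<open>e > 0\<close> the choice \<open>d = D\<^sup>-\<^sup>1\<^sup>/\<^sup>(\<^sup>r\<^sup>+\<^sup>1\<^sup>) e\<^sup>r\<^sup>/\<^sup>(\<^sup>r\<^sup>+\<^sup>1\<^sup>)\<close> balances the two terms of the previous bound.\<close>

lemma (in prob_space) prob_between_le:
  fixes f :: "real \<Rightarrow> real"
  assumes X: "distributed M lborel X f" and f: "\<And>x. 0 \<le> f x" "\<And>x. f x \<le> D"
    and meas: "X \<in> borel_measurable M" "Y \<in> borel_measurable M"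
    and r: "0 < r" and int: "integrable M (\<lambda>\<omega>. \<bar>X \<omega> - Y \<omega>\<bar> powr r)"
    and e: "Lr_norm M r (\<lambda>\<omega>. X \<omega> - Y \<omega>) \<le> e"
  shows "prob (between_event M X Y z) \<le> 3 * (D * e) powr (r / (r + 1))"
proof (cases "e = 0")
  case True
  have D: "0 < D" by (rule density_bound_pos[OF X f])
  \<comment> \<open>For \<open>e = 0\<close> the second term of the split vanishes, and
    \<open>d = s / (2 * D)\<close> makes the first one equal to an arbitrary
    \<open>s > 0\<close>.\<close>
  have "prob (between_event M X Y z) \<le> 0 + s" if "0 < s" for s
    using prob_between_le_split[OF X f meas r int e, of "s / (2 * D)" z] that True D by simp
  then have "prob (between_event M X Y z) \<le> 0" by (rule field_le_epsilon)
  then show ?thesis using True by simp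
next
  case False
  then have e0: "0 < e" using e Lr_norm_nonneg[of M r "\<lambda>\<omega>. X \<omega> - Y \<omega>"] by linarith
  have D: "0 < D" by (rule density_bound_pos[OF X f])
  define d where "d = D powr (- (1 / (r + 1))) * e powr (r / (r + 1))"
  have ex: "1 + - (1 / (r + 1)) = r / (r + 1)" "r - r / (r + 1) * r = r / (r + 1)"
    using r by (simp_all add: field_simps power2_eq_square)
  have "D * d = D powr (1 + - (1 / (r + 1))) * e powr (r / (r + 1))"
    unfolding d_def powr_add using D by simp
  then have 1: "D * d = (D * e) powr (r / (r + 1))"
    unfolding ex using D e0 by (simp add: powr_mult)
  have "d powr r = D powr (- (r / (r + 1))) * e powr (r / (r + 1) * r)"
    unfolding d_def using D e0 by (simp add: powr_mult powr_powr)
  then have "e powr r / d powr r = D powr (r / (r + 1)) * e powr (r - r / (r + 1) * r)"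
    by (simp add: powr_minus powr_diff field_simps)
  then have 2: "e powr r / d powr r = (D * e) powr (r / (r + 1))"
    unfolding ex using D e0 by (simp add: powr_mult)
  have "0 < d" using D e0 by (simp add: d_def)
  \<comment> \<open>The density term is two copies of the common value and the Markov term is one
    copy: this is the constant 3.\<close>
  from prob_between_le_split[OF X f meas r int e this, of z] show ?thesis
    using 1 2 by simp
qed

text \<open>On the crossing event \<open>X\<close> or \<open>Y\<close> has modulus at least
  \<open>\<bar>z\<bar>\<close>. Markov's inequality applies to both, with the norm of
  \<open>Y\<close> controlled by Minkowski's inequality; the factor 2 counts the two events.\<close>

lemma (in prob_space) prob_between_tail_le:
  fixes X Y :: "'a \<Rightarrow> real"
  assumes meas[measurable]: "X \<in> borel_measurable M" "Y \<in> borel_measurable M"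
    and r: "1 \<le> r"
    and int: "integrable M (\<lambda>\<omega>. \<bar>X \<omega>\<bar> powr r)" "integrable M (\<lambda>\<omega>. \<bar>X \<omega> - Y \<omega>\<bar> powr r)"
    and le: "Lr_norm M r (\<lambda>\<omega>. X \<omega> - Y \<omega>) \<le> c" and z: "z \<noteq> 0"
  shows "prob (between_event M X Y z) \<le> 2 * ((c + Lr_norm M r X) powr r / \<bar>z\<bar> powr r)"
proof -
  let ?P = "prob (between_event M X Y z)"
  define a where "a = c + Lr_norm M r X"
  have c: "0 \<le> c" using le Lr_norm_nonneg order_trans by blast
  \<comment> \<open>Both norm bounds are enlarged by \<open>s\<close>, since
    \<open>integral_sum_powr_le\<close> asks for positive ones; \<open>s\<close> tends to 0 at the
    end.\<close>
  have key: "?P \<le> 2 * ((a + 2 * s) powr r / \<bar>z\<bar> powr r)" if s: "0 < s" for s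
  proof -
    let ?A = "\<lambda>X. {\<omega> \<in> space M. \<bar>z\<bar> powr r \<le> \<bar>X \<omega>\<bar> powr r}"
    let ?n = "Lr_norm M r X + s" and ?c = "c + s"
    have pos: "0 < ?n" "0 < ?c" using Lr_norm_nonneg[of M r X] c s by auto
    note iY = integral_sum_powr_le[OF meas r int pos]
    have le': "Lr_norm M r X \<le> ?n" "Lr_norm M r (\<lambda>\<omega>. X \<omega> - Y \<omega>) \<le> ?c"
      using s le by auto
    have X: "(\<integral>\<omega>. \<bar>X \<omega>\<bar> powr r \<partial>M) \<le> (a + 2 * s) powr r"
      using integral_powr_le_of_Lr_norm_le[of r M X "a + 2 * s"] r c s by (simp add: a_def)
    have Y: "(\<integral>\<omega>. \<bar>Y \<omega>\<bar> powr r \<partial>M) \<le> (a + 2 * s) powr r"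
      using iY(2)[OF le'] by (simp add: a_def algebra_simps)
    have "\<bar>z\<bar> \<le> \<bar>X \<omega>\<bar> \<or> \<bar>z\<bar> \<le> \<bar>Y \<omega>\<bar>" if "\<omega> \<in> between_event M X Y z" for \<omega>
      using that by (auto simp: between_event_def)
    then have "between_event M X Y z \<subseteq> ?A X \<union> ?A Y"
      using r by (fastforce simp: between_event_def intro: powr_mono2)
    then have "?P \<le> prob (?A X \<union> ?A Y)"
      by (intro finite_measure_mono) auto
    also have "\<dots> \<le> prob (?A X) + prob (?A Y)"
      by (intro measure_Un_le) auto
    also have "\<dots> \<le> (\<integral>\<omega>. \<bar>X \<omega>\<bar> powr r \<partial>M) / \<bar>z\<bar> powr r + (\<integral>\<omega>. \<bar>Y \<omega>\<bar> powr r \<partial>M) / \<bar>z\<bar> powr r"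
      using r z iY(1)[OF le'] int by (intro add_mono prob_abs_ge_le) auto
    also have "\<dots> \<le> (a + 2 * s) powr r / \<bar>z\<bar> powr r + (a + 2 * s) powr r / \<bar>z\<bar> powr r"
      by (intro add_mono divide_right_mono X Y) auto
    finally show ?thesis by simp
  qed
  have a: "0 \<le> a" using c Lr_norm_nonneg[of M r X] by (simp add: a_def)
  have lim: "((\<lambda>s. 2 * ((a + 2 * s) powr r / \<bar>z\<bar> powr r)) \<longlongrightarrow> 2 * ((a + 2 * 0) powr r / \<bar>z\<bar> powr r)) (at_right 0)"
    using r z a by (intro tendsto_intros tendsto_powr2) (auto simp: eventually_at_filter)
  have "?P \<le> 2 * ((a + 2 * 0) powr r / \<bar>z\<bar> powr r)"
    by (rule tendsto_lowerbound[OF lim eventually_mono[OF eventually_at_right_less key]])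
      (simp_all add: trivial_limit_at_right_real)
  then show ?thesis by (simp add: a_def)
qed

subsection \<open>Integrating the crossing probabilities\<close>

text \<open>Hoelder's inequality with exponent \<open>p\<close> for the finite measure \<open>\<phi>\<^sup>1\<^sup>+\<^sup>1\<^sup>/\<^sup>p dN\<close>, in the form given by
  Young's inequality \<open>p t\<^sup>p\<^sup>-\<^sup>1 u \<le> u\<^sup>p + (p - 1) t\<^sup>p\<close> for \<open>u = \<phi>\<^sup>-\<^sup>1\<^sup>/\<^sup>p\<close>, which needs no integrability.\<close>

lemma Young_weighted:
  fixes t w p :: real
  assumes "1 \<le> p" "0 < t" "0 < w"
  shows "p * t powr (p - 1) * w \<le> w powr (1/p) + (p - 1) * t powr p * w powr (1 + 1/p)"
proof -
  have "(w powr (-1)) powr (1/p) * (t powr p) powr (1 - 1/p) \<le> 1/p * (w powr (-1)) + (1 - 1/p) * t powr p"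
    using assms by (intro Youngs_inequality_0) auto
  moreover have "p * (1 - 1/p) = p - 1"
    using assms by (simp add: field_simps)
  ultimately have "w powr (- (1/p)) * t powr (p - 1) \<le> 1/p * (w powr (-1)) + (1 - 1/p) * t powr p"
    by (simp only: powr_powr mult_minus1)
  then have "p * w powr (1 + 1/p) * (w powr (- (1/p)) * t powr (p - 1))
      \<le> p * w powr (1 + 1/p) * (1/p * (w powr (-1)) + (1 - 1/p) * t powr p)"
    using assms by (intro mult_left_mono) auto
  also have "\<dots> = w powr (1 + 1/p) * w powr (-1) + (p * (1 - 1/p)) * t powr p * w powr (1 + 1/p)"
    using assms by (simp add: algebra_simps)
  also have "\<dots> = w powr (1/p) + (p - 1) * t powr p * w powr (1 + 1/p)"
    using \<open>p * (1 - 1/p) = p - 1\<close> powr_add[of w "1 + 1/p" "-1"] by simp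
  also have "p * w powr (1 + 1/p) * (w powr (- (1/p)) * t powr (p - 1))
      = p * t powr (p - 1) * (w powr (1 + 1/p) * w powr (- (1/p)))"
    by simp
  also have "w powr (1 + 1/p) * w powr (- (1/p)) = w"
    using assms by (simp flip: powr_add)
  finally show ?thesis .
qed

text \<open>Hoelder in \<open>z\<close> followed by Tonelli. The measure \<open>N\<close> is left
  abstract so that the same estimate serves the total variation of \<open>\<mu>\<close> and the
  weighted counting measure of the atoms.\<close>

lemma (in prob_space) nn_integral_powr_le:
  fixes D :: "'a \<Rightarrow> real" and \<phi> :: "'b \<Rightarrow> real"
  assumes N: "sigma_finite_measure N"
    and \<phi>[measurable]: "\<phi> \<in> borel_measurable N" and pos: "\<And>z. 0 < \<phi> z"
    and H: "{x \<in> space (N \<Otimes>\<^sub>M M). snd x \<in> H (fst x)} \<in> sets (N \<Otimes>\<^sub>M M)"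
    and HM: "\<And>z. H z \<in> sets M"
    and prob: "\<And>z. prob (H z) \<le> K * \<phi> z" and K: "0 \<le> K"
    and V: "(\<integral>\<^sup>+z. ennreal (\<phi> z powr (1 + 1/p)) \<partial>N) \<le> ennreal V" "0 \<le> V" and p: "1 \<le> p"
    and D0: "\<And>\<omega>. 0 \<le> D \<omega>"
    and D: "\<And>\<omega>. \<omega> \<in> space M \<Longrightarrow> ennreal (D \<omega>) \<le> (\<integral>\<^sup>+z. ennreal (\<phi> z) * indicator (H z) \<omega> \<partial>N)"
  shows "(\<integral>\<^sup>+\<omega>. ennreal (D \<omega> powr p) \<partial>M) \<le> ennreal (K * V powr p)"
proof -
  interpret N: sigma_finite_measure N by (rule N)
  interpret NM: pair_sigma_finite N M by unfold_locales
  have ind: "(\<lambda>x. indicator (H (fst x)) (snd x) :: ennreal) \<in> borel_measurable (N \<Otimes>\<^sub>M M)"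
  proof -
    have "(\<lambda>x. indicator {x \<in> space (N \<Otimes>\<^sub>M M). snd x \<in> H (fst x)} x :: ennreal) \<in> borel_measurable (N \<Otimes>\<^sub>M M)"
      using H by measurable
    then show ?thesis
      by (rule measurable_cong[THEN iffD1, rotated]) (auto simp: indicator_def)
  qed
  have [measurable]: "(\<lambda>z. indicator (H z) \<omega> :: ennreal) \<in> borel_measurable N" if "\<omega> \<in> space M" for \<omega>
    using measurable_compose[OF measurable_Pair2'[OF that] ind] by simp
  show ?thesis
  proof (cases "V = 0")
    case True
    then have "(\<integral>\<^sup>+z. ennreal (\<phi> z powr (1 + 1/p)) \<partial>N) = 0" using V by simp
    then have "AE z in N. ennreal (\<phi> z powr (1 + 1/p)) = 0"
      by (subst (asm) nn_integral_0_iff_AE) auto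
    then have "AE z in N. False"
    proof (rule AE_mp, intro AE_I2 impI)
      fix z show "ennreal (\<phi> z powr (1 + 1/p)) = 0 \<Longrightarrow> False" using pos[of z] by simp
    qed
    then have 0: "(\<integral>\<^sup>+z. ennreal (\<phi> z) * indicator (H z) \<omega> \<partial>N) = 0" for \<omega>
      by (subst nn_integral_cong_AE[where v="\<lambda>_. 0"]) auto
    have "D \<omega> = 0" if "\<omega> \<in> space M" for \<omega>
      using D[OF that] D0[of \<omega>] unfolding 0 by simp
    then have "(\<integral>\<^sup>+\<omega>. ennreal (D \<omega> powr p) \<partial>M) = (\<integral>\<^sup>+\<omega>. 0 \<partial>M)"
      by (intro nn_integral_cong) simp
    then show ?thesis by simp
  next
    case False
    then have V0: "0 < V" using V by simp
    \<comment> \<open>\<open>U\<close> is what remains of the Hoelder estimate: the claim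
      \<open>pt\<close> reads \<open>D^p \<le> V^(p-1) * U\<close>.\<close>
    define U where "U \<omega> = (\<integral>\<^sup>+z. ennreal (\<phi> z powr (1/p)) * indicator (H z) \<omega> \<partial>N)" for \<omega>
    have Um: "(\<lambda>x. ennreal (\<phi> (snd x) powr (1/p)) * indicator (H (snd x)) (fst x)) \<in> borel_measurable (M \<Otimes>\<^sub>M N)"
    proof -
      have "(\<lambda>x. ennreal (\<phi> (fst x) powr (1/p)) * indicator (H (fst x)) (snd x)) \<in> borel_measurable (N \<Otimes>\<^sub>M M)"
        using ind by measurable
      from measurable_compose[OF measurable_pair_swap' this] show ?thesis
        by (simp add: case_prod_beta)
    qed
    have U[measurable]: "U \<in> borel_measurable M"
      unfolding U_def by (rule N.borel_measurable_nn_integral) (use Um in \<open>simp add: case_prod_beta\<close>)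
    have pt: "ennreal (D \<omega> powr p * V powr (1 - p)) \<le> U \<omega>" if \<omega>: "\<omega> \<in> space M" for \<omega>
    proof (cases "D \<omega> = 0")
      case False
      then have "0 < D \<omega>" using D0[of \<omega>] by simp
      \<comment> \<open>This \<open>t\<close> makes \<open>t^(p-1) * D\<close> and
        \<open>t^p * V\<close> equal to the same number \<open>Q\<close>, so Young's inequality
        integrates to \<open>p * Q \<le> U + (p - 1) * Q\<close>.\<close>
      define t where "t = D \<omega> / V"
      have t: "0 < t" using \<open>0 < D \<omega>\<close> V0 by (simp add: t_def)
      define Q where "Q = D \<omega> powr p * V powr (1 - p)"
      have Q0: "0 \<le> Q" by (simp add: Q_def)
      have v: "V powr (1 - p) = 1 / V powr (p - 1)"
        using powr_minus_divide[of V "p - 1"] by simp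
      have "t powr (p - 1) * D \<omega> = D \<omega> powr (p - 1 + 1) * V powr (1 - p)"
        unfolding powr_add v using \<open>0 < D \<omega>\<close> V0 by (simp add: t_def powr_divide)
      then have q1: "t powr (p - 1) * D \<omega> = Q" by (simp add: Q_def)
      have "t powr p * V = D \<omega> powr p * V powr (1 + - p)"
        unfolding powr_add using \<open>0 < D \<omega>\<close> V0 by (simp add: t_def powr_divide powr_minus field_simps)
      then have q2: "t powr p * V = Q" by (simp add: Q_def)
      have "ennreal (p * Q) = ennreal (p * t powr (p - 1)) * ennreal (D \<omega>)"
        using p D0[of \<omega>] by (simp add: ennreal_mult'[symmetric] mult.assoc q1)
      also have "\<dots> \<le> ennreal (p * t powr (p - 1)) * (\<integral>\<^sup>+z. ennreal (\<phi> z) * indicator (H z) \<omega> \<partial>N)"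
        by (intro mult_left_mono D \<omega>) simp
      also have "\<dots> = (\<integral>\<^sup>+z. ennreal (p * t powr (p - 1)) * (ennreal (\<phi> z) * indicator (H z) \<omega>) \<partial>N)"
        using \<omega> by (subst nn_integral_cmult) auto
      \<comment> \<open>The indicator is dropped from the second term only, whose integral is then
        bounded through \<open>V\<close>.\<close>
      also have "\<dots> \<le> (\<integral>\<^sup>+z. ennreal (\<phi> z powr (1/p)) * indicator (H z) \<omega>
          + ennreal ((p - 1) * t powr p) * ennreal (\<phi> z powr (1 + 1/p)) \<partial>N)"
      proof (intro nn_integral_mono)
        fix z
        have "ennreal (p * t powr (p - 1) * \<phi> z)
            \<le> ennreal (\<phi> z powr (1/p) + (p - 1) * t powr p * \<phi> z powr (1 + 1/p))"
          using p t pos by (intro ennreal_leI Young_weighted) auto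
        then show "ennreal (p * t powr (p - 1)) * (ennreal (\<phi> z) * indicator (H z) \<omega>)
          \<le> ennreal (\<phi> z powr (1/p)) * indicator (H z) \<omega>
            + ennreal ((p - 1) * t powr p) * ennreal (\<phi> z powr (1 + 1/p))"
          using p pos[of z]
          by (cases "\<omega> \<in> H z") (auto simp: ennreal_mult'[symmetric] ennreal_plus[symmetric] simp del: ennreal_plus)
      qed
      also have "\<dots> = U \<omega> + ennreal ((p - 1) * t powr p) * (\<integral>\<^sup>+z. ennreal (\<phi> z powr (1 + 1/p)) \<partial>N)"
        unfolding U_def using \<omega> by (subst nn_integral_add) (auto simp: nn_integral_cmult)
      also have "\<dots> \<le> U \<omega> + ennreal ((p - 1) * t powr p) * ennreal V"
        by (intro add_left_mono mult_left_mono V) simp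
      also have "\<dots> = U \<omega> + ennreal ((p - 1) * Q)"
        using p V0 by (simp add: ennreal_mult'[symmetric] mult.assoc q2)
      finally have le: "ennreal (p * Q) \<le> U \<omega> + ennreal ((p - 1) * Q)" .
      show ?thesis
        unfolding Q_def[symmetric]
      \<comment> \<open>Cancelling \<open>(p - 1) * Q\<close> requires a finite
        \<open>U \<omega>\<close>; for an infinite one the claim is trivial.\<close>
      proof (cases "U \<omega>")
        case (real u)
        have "ennreal (p * Q) \<le> ennreal (u + (p - 1) * Q)"
          using le real p Q0 by (simp add: ennreal_plus)
        then have "p * Q \<le> u + (p - 1) * Q"
          using real p Q0 by (subst (asm) ennreal_le_iff) auto
        then have "Q \<le> u" by (simp add: algebra_simps)
        then show "ennreal Q \<le> U \<omega>" using real by (simp add: ennreal_leI)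
      qed simp
    qed simp
    have "(\<integral>\<^sup>+\<omega>. ennreal (D \<omega> powr p) \<partial>M)
        = (\<integral>\<^sup>+\<omega>. ennreal (V powr (p - 1)) * ennreal (D \<omega> powr p * V powr (1 - p)) \<partial>M)"
    proof (intro nn_integral_cong)
      fix \<omega>
      have "V powr (p - 1) * V powr (1 - p) = 1"
        using V0 by (simp flip: powr_add)
      then have "V powr (p - 1) * (D \<omega> powr p * V powr (1 - p)) = D \<omega> powr p"
        by (metis mult.left_commute mult.right_neutral)
      then show "ennreal (D \<omega> powr p) = ennreal (V powr (p - 1)) * ennreal (D \<omega> powr p * V powr (1 - p))"
        by (simp add: ennreal_mult'[symmetric])
    qed
    also have "\<dots> \<le> (\<integral>\<^sup>+\<omega>. ennreal (V powr (p - 1)) * U \<omega> \<partial>M)"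
      by (intro nn_integral_mono mult_left_mono pt) auto
    also have "\<dots> = ennreal (V powr (p - 1)) * (\<integral>\<^sup>+\<omega>. U \<omega> \<partial>M)"
      by (intro nn_integral_cmult) measurable
    also have "(\<integral>\<^sup>+\<omega>. U \<omega> \<partial>M)
        = (\<integral>\<^sup>+z. (\<integral>\<^sup>+\<omega>. ennreal (\<phi> z powr (1/p)) * indicator (H z) \<omega> \<partial>M) \<partial>N)"
      unfolding U_def by (rule NM.Fubini') (use ind in measurable)
    also have "\<dots> = (\<integral>\<^sup>+z. ennreal (\<phi> z powr (1/p)) * emeasure M (H z) \<partial>N)"
      using HM by (intro nn_integral_cong nn_integral_cmult_indicator) auto
    \<comment> \<open>The weight \<open>\<phi>^(1/p)\<close> left by Hoelder and the bound
      \<open>K * \<phi>\<close> on the probability combine to \<open>\<phi>^(1+1/p)\<close>, the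
      integrand controlled by \<open>V\<close>.\<close>
    also have "\<dots> \<le> (\<integral>\<^sup>+z. ennreal K * ennreal (\<phi> z powr (1 + 1/p)) \<partial>N)"
    proof (intro nn_integral_mono)
      fix z
      have "\<phi> z powr (1/p) * prob (H z) \<le> \<phi> z powr (1/p) * (K * \<phi> z)"
        by (intro mult_left_mono prob) simp
      also have "\<dots> = K * \<phi> z powr (1 + 1/p)"
        unfolding powr_add using pos[of z] by simp
      finally show "ennreal (\<phi> z powr (1/p)) * emeasure M (H z) \<le> ennreal K * ennreal (\<phi> z powr (1 + 1/p))"
        using K by (simp add: emeasure_eq_measure ennreal_mult'[symmetric] ennreal_leI)
    qed
    also have "\<dots> = ennreal K * (\<integral>\<^sup>+z. ennreal (\<phi> z powr (1 + 1/p)) \<partial>N)"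
      by (intro nn_integral_cmult) measurable
    also have "ennreal (V powr (p - 1)) * \<dots> \<le> ennreal (V powr (p - 1)) * (ennreal K * ennreal V)"
      by (intro mult_left_mono V) auto
    also have "\<dots> = ennreal (K * (V powr (p - 1) * V powr 1))"
      using K V0 by (simp add: ennreal_mult'[symmetric] mult_ac)
    also have "V powr (p - 1) * V powr 1 = V powr p"
      using powr_add[of V "p - 1" 1] by simp
    finally show ?thesis by (simp add: mult_left_mono)
  qed
qed

subsection \<open>Increments of functions of bounded weighted variation\<close>

lemma signed_measures_sets:
  assumes "\<mu> \<in> signed_measures"
  shows "sets (fst \<mu>) = sets borel" "sets (snd \<mu>) = sets borel"
  using assms by (auto simp: signed_measures_def)

lemma sets_total_variation [simp, measurable_cong]: "sets (total_variation \<mu>) = sets borel"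
  unfolding total_variation_def using sets.sets_measure_of_eq[of "borel :: real measure"] by simp

lemma space_total_variation [simp]: "space (total_variation \<mu>) = UNIV"
  by (simp add: total_variation_def space_measure_of_conv)

lemma emeasure_total_variation:
  assumes s: "sets (fst \<mu>) = sets borel" "sets (snd \<mu>) = sets borel" and A: "A \<in> sets borel"
  shows "emeasure (total_variation \<mu>) A = emeasure (fst \<mu>) A + emeasure (snd \<mu>) A"
  unfolding total_variation_def
proof (rule emeasure_measure_of_sigma)
  show "sigma_algebra UNIV (sets (borel :: real measure))"
    using sets.sigma_algebra_axioms[of "borel :: real measure"] by simp
  show "positive (sets borel) (\<lambda>A. emeasure (fst \<mu>) A + emeasure (snd \<mu>) A)"
    by (simp add: positive_def)
  show "countably_additive (sets borel) (\<lambda>A. emeasure (fst \<mu>) A + emeasure (snd \<mu>) A)"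
  proof (rule countably_additiveI)
    fix B :: "nat \<Rightarrow> real set"
    assume B: "range B \<subseteq> sets borel" "disjoint_family B"
    have "(\<Sum>i. emeasure (fst \<mu>) (B i) + emeasure (snd \<mu>) (B i))
        = (\<Sum>i. emeasure (fst \<mu>) (B i)) + (\<Sum>i. emeasure (snd \<mu>) (B i))"
      by (rule suminf_add[symmetric]) auto
    also have "\<dots> = emeasure (fst \<mu>) (\<Union>i. B i) + emeasure (snd \<mu>) (\<Union>i. B i)"
      using B s by (simp add: suminf_emeasure)
    finally show "(\<Sum>i. emeasure (fst \<mu>) (B i) + emeasure (snd \<mu>) (B i))
        = emeasure (fst \<mu>) (\<Union>i. B i) + emeasure (snd \<mu>) (\<Union>i. B i)" .
  qed
qed (rule A)

text \<open>On the Hahn set \<open>S\<close> the negative part vanishes, so there the total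
  variation is the positive part; symmetrically on the complement. Both integrals in
  \<open>signed_integral\<close> thereby become integrals against one measure.\<close>

lemma Jordan_parts_density:
  assumes "\<mu> \<in> signed_measures"
  obtains S where "S \<in> sets borel"
    "fst \<mu> = density (total_variation \<mu>) (\<lambda>z. ennreal (indicator S z))"
    "snd \<mu> = density (total_variation \<mu>) (\<lambda>z. ennreal (indicator (- S) z))"
proof -
  obtain S where S: "S \<in> sets borel" "emeasure (fst \<mu>) (- S) = 0" "emeasure (snd \<mu>) S = 0"
    using assms by (auto simp: signed_measures_def)
  note s = signed_measures_sets[OF assms]
  have S': "- S \<in> sets borel" using S by simp
  \<comment> \<open>Stated for a pair \<open>\<nu>\<close>, \<open>\<nu>'\<close> because it is used
    twice, with the two Jordan parts exchanged.\<close>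
  have *: "\<nu> = density (total_variation \<mu>) (\<lambda>z. ennreal (indicator R z))"
    if \<nu>: "sets \<nu> = sets borel" "emeasure \<nu> (- R) = 0" and R: "R \<in> sets borel"
      and eq: "\<And>A. A \<in> sets borel \<Longrightarrow> emeasure (total_variation \<mu>) A = emeasure \<nu> A + emeasure \<nu>' A"
      and \<nu>': "sets \<nu>' = sets borel" "emeasure \<nu>' R = 0" for \<nu> \<nu>' :: "real measure" and R
  proof (rule measure_eqI)
    fix A assume "A \<in> sets \<nu>"
    then have A[measurable]: "A \<in> sets borel" using \<nu> by simp
    note [measurable] = R
    have "emeasure (density (total_variation \<mu>) (\<lambda>z. ennreal (indicator R z))) A
        = (\<integral>\<^sup>+z. ennreal (indicator R z) * indicator A z \<partial>total_variation \<mu>)"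
      by (rule emeasure_density) auto
    also have "\<dots> = (\<integral>\<^sup>+z. indicator (A \<inter> R) z \<partial>total_variation \<mu>)"
      by (intro nn_integral_cong) (auto split: split_indicator)
    also have "\<dots> = emeasure (total_variation \<mu>) (A \<inter> R)"
      by (rule nn_integral_indicator) (use A R in simp)
    also have "\<dots> = emeasure \<nu> (A \<inter> R) + emeasure \<nu>' (A \<inter> R)"
      by (rule eq) simp
    also have "emeasure \<nu>' (A \<inter> R) = 0"
      by (rule emeasure_eq_0[OF _ \<nu>'(2)]) (use \<nu>' R in auto)
    also have "emeasure \<nu> (A \<inter> R) = emeasure \<nu> A"
    proof -
      have "emeasure \<nu> A = emeasure \<nu> (A \<inter> R) + emeasure \<nu> (A - R)"
        using \<nu> A R by (subst plus_emeasure) (auto intro!: arg_cong[where f="emeasure \<nu>"])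
      moreover have "emeasure \<nu> (A - R) = 0"
        by (rule emeasure_eq_0[OF _ \<nu>(2)]) (use \<nu> R in auto)
      ultimately show ?thesis by simp
    qed
    finally show "emeasure \<nu> A = emeasure (density (total_variation \<mu>) (\<lambda>z. ennreal (indicator R z))) A"
      by simp
  qed (use \<nu> in simp)
  show ?thesis
  proof (rule that[OF S(1)])
    show "fst \<mu> = density (total_variation \<mu>) (\<lambda>z. ennreal (indicator S z))"
      by (rule *[where \<nu>'="snd \<mu>"]) (use s S emeasure_total_variation[OF s] in auto)
    show "snd \<mu> = density (total_variation \<mu>) (\<lambda>z. ennreal (indicator (- S) z))"
      by (rule *[where \<nu>'="fst \<mu>"]) (use s S emeasure_total_variation[OF s] in \<open>auto simp: add.commute\<close>)
  qed
qed

text \<open>One formula for both half lines: \<open>{0<..x} \<union> {x<..0}\<close> is \<open>{0<..x}\<close> for \<open>x \<ge> 0\<close> and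
  \<open>{x<..0}\<close> for \<open>x < 0\<close>.\<close>

definition origin_interval :: "real \<Rightarrow> real set" where
  "origin_interval x = {0<..x} \<union> {x<..0}"

lemma indicator_origin_interval:
  "indicator (origin_interval x) z = (if (0 < z \<and> z \<le> x) \<or> (x < z \<and> z \<le> 0) then 1 else 0)"
  by (auto simp: origin_interval_def indicator_def)

text \<open>The function \<open>s\<close> is the density of \<open>\<mu>\<close> with respect to its
  total variation, 1 on the Hahn set and -1 off it. Local integrability of \<open>\<phi>\<close>
  ensures that no Bochner integral here takes its default value 0.\<close>

lemma g_part_eq_integral:
  assumes \<mu>: "\<mu> \<in> M_class p \<phi>" and [measurable]: "\<phi> \<in> borel_measurable borel"
  obtains s :: "real \<Rightarrow> real" where "s \<in> borel_measurable borel" "\<And>z. \<bar>s z\<bar> = 1"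
    "\<And>x. integrable (total_variation \<mu>) (\<lambda>z. \<phi> z * indicator (origin_interval x) z)"
    "\<And>x. g_part \<phi> \<mu> x = (\<integral>z. s z * (\<phi> z * indicator (origin_interval x) z) \<partial>total_variation \<mu>)"
proof -
  let ?N = "total_variation \<mu>"
  have sm: "\<mu> \<in> signed_measures" using \<mu> by (simp add: M_class_def)
  obtain S where S[measurable]: "S \<in> sets borel"
    and fst: "fst \<mu> = density ?N (\<lambda>z. ennreal (indicator S z))"
    and snd: "snd \<mu> = density ?N (\<lambda>z. ennreal (indicator (- S) z))"
    using Jordan_parts_density[OF sm] .
  have int: "integrable ?N (\<lambda>z. \<phi> z * indicator B z)" if B: "B \<in> sets borel" "B \<subseteq> {-\<bar>x\<bar>..\<bar>x\<bar>}" for B x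
  proof -
    have "set_integrable ?N {-\<bar>x\<bar>..\<bar>x\<bar>} \<phi>"
      using \<mu> by (auto simp: M_class_def)
    then have "set_integrable ?N B \<phi>"
      by (rule set_integrable_subset) (use B in auto)
    then show ?thesis by (simp add: set_integrable_def mult.commute)
  qed
  have sig: "signed_integral \<mu> B \<phi>
      = (\<integral>z. (indicator S z - indicator (- S) z) * (\<phi> z * indicator B z) \<partial>?N)"
    if B[measurable]: "B \<in> sets borel" "B \<subseteq> {-\<bar>x\<bar>..\<bar>x\<bar>}" for B x
  proof -
    have i: "integrable ?N (\<lambda>z. indicator R z * (\<phi> z * indicator B z))" if [measurable]: "R \<in> sets borel" for R
      by (rule Bochner_Integration.integrable_bound[OF int[OF B]]) (auto simp: indicator_def)
    have "signed_integral \<mu> B \<phi> = (\<integral>z. indicator S z * (\<phi> z * indicator B z) \<partial>?N)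
        - (\<integral>z. indicator (- S) z * (\<phi> z * indicator B z) \<partial>?N)"
      unfolding signed_integral_def set_lebesgue_integral_def fst snd
      by (simp add: integral_density mult.commute)
    also have "\<dots> = (\<integral>z. indicator S z * (\<phi> z * indicator B z)
        - indicator (- S) z * (\<phi> z * indicator B z) \<partial>?N)"
      by (rule Bochner_Integration.integral_diff[symmetric]; rule i) auto
    finally show ?thesis by (simp add: left_diff_distrib)
  qed
  have sub: "{0<..x} \<subseteq> {-\<bar>x\<bar>..\<bar>x\<bar>}" "{x<..0} \<subseteq> {-\<bar>x\<bar>..\<bar>x\<bar>}" "origin_interval x \<subseteq> {-\<bar>x\<bar>..\<bar>x\<bar>}" for x :: real
    by (auto simp: origin_interval_def)
  show ?thesis
  proof (rule that[of "\<lambda>z. indicator S z - indicator (- S) z"])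
    fix x
    have "origin_interval x = (if x \<ge> 0 then {0<..x} else {x<..0})"
      by (auto simp: origin_interval_def)
    then show "g_part \<phi> \<mu> x = (\<integral>z. (indicator S z - indicator (- S) z)
        * (\<phi> z * indicator (origin_interval x) z) \<partial>?N)"
      using sig[OF _ sub(1)] sig[OF _ sub(2)] by (simp add: g_part_def)
  next
    fix x show "integrable ?N (\<lambda>z. \<phi> z * indicator (origin_interval x) z)"
      by (rule int[OF _ sub(3)]) (simp add: origin_interval_def)
  qed (auto simp: indicator_def)
qed

lemma borel_measurable_g_part:
  assumes \<mu>: "\<mu> \<in> M_class p \<phi>" and [measurable]: "\<phi> \<in> borel_measurable borel"
  shows "g_part \<phi> \<mu> \<in> borel_measurable borel"
proof -
  interpret sigma_finite_measure "total_variation \<mu>"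
    using \<mu> by (simp add: M_class_def signed_measures_def)
  obtain s :: "real \<Rightarrow> real" where [measurable]: "s \<in> borel_measurable borel"
    and eq: "\<And>x. g_part \<phi> \<mu> x = (\<integral>z. s z * (\<phi> z * indicator (origin_interval x) z) \<partial>total_variation \<mu>)"
    using g_part_eq_integral[OF assms] by metis
  have "(\<lambda>x. \<integral>z. s z * (\<phi> z * indicator (origin_interval x) z) \<partial>total_variation \<mu>) \<in> borel_measurable borel"
    unfolding indicator_origin_interval by (rule borel_measurable_lebesgue_integral) measurable
  then show ?thesis using eq by (simp cong: measurable_cong)
qed

text \<open>The indicators of the origin intervals of \<open>x\<close> and \<open>y\<close> agree
  outside the closed interval spanned by \<open>x\<close> and \<open>y\<close>, and inside they
  differ by at most 1. This includes points on opposite sides of 0, where the two origin intervals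
  are disjoint.\<close>

lemma g_part_diff_le:
  assumes \<mu>: "\<mu> \<in> M_class p \<phi>" and [measurable]: "\<phi> \<in> borel_measurable borel" and pos: "\<And>z. 0 < \<phi> z"
  shows "ennreal \<bar>g_part \<phi> \<mu> x - g_part \<phi> \<mu> y\<bar>
    \<le> (\<integral>\<^sup>+z. ennreal (\<phi> z) * indicator {min x y..max x y} z \<partial>total_variation \<mu>)"
proof -
  let ?N = "total_variation \<mu>"
  let ?I = "\<lambda>x z. indicator (origin_interval x) z :: real"
  obtain s :: "real \<Rightarrow> real" where [measurable]: "s \<in> borel_measurable borel" and s: "\<And>z. \<bar>s z\<bar> = 1"
    and int: "\<And>x. integrable ?N (\<lambda>z. \<phi> z * ?I x z)"
    and eq: "\<And>x. g_part \<phi> \<mu> x = (\<integral>z. s z * (\<phi> z * ?I x z) \<partial>?N)"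
    using g_part_eq_integral[OF assms(1,2)] by metis
  have int': "integrable ?N (\<lambda>z. s z * (\<phi> z * ?I x z))" for x
    by (rule Bochner_Integration.integrable_bound[OF int[of x]])
      (auto simp: abs_mult s indicator_origin_interval)
  let ?d = "\<lambda>z. s z * (\<phi> z * ?I x z) - s z * (\<phi> z * ?I y z)"
  have diff: "(\<integral>z. ?d z \<partial>?N) = g_part \<phi> \<mu> x - g_part \<phi> \<mu> y"
    unfolding eq by (rule Bochner_Integration.integral_diff[OF int' int'])
  have "ennreal \<bar>g_part \<phi> \<mu> x - g_part \<phi> \<mu> y\<bar> \<le> (\<integral>\<^sup>+z. norm (?d z) \<partial>?N)"
    using integral_norm_bound_ennreal[OF Bochner_Integration.integrable_diff[OF int'[of x] int'[of y]]]
    unfolding diff real_norm_def .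
  also have "\<dots> \<le> (\<integral>\<^sup>+z. ennreal (\<phi> z) * indicator {min x y..max x y} z \<partial>?N)"
  proof (intro nn_integral_mono)
    fix z
    have "norm (s z * (\<phi> z * ?I x z) - s z * (\<phi> z * ?I y z)) = \<bar>s z\<bar> * (\<phi> z * \<bar>?I x z - ?I y z\<bar>)"
      using pos[of z] by (simp flip: right_diff_distrib add: abs_mult)
    also have "\<dots> \<le> \<phi> z * indicator {min x y..max x y} z"
      using s[of z] pos[of z]
      by (auto intro!: mult_left_mono simp: indicator_origin_interval split: split_indicator)
    finally show "ennreal (norm (s z * (\<phi> z * ?I x z) - s z * (\<phi> z * ?I y z)))
        \<le> ennreal (\<phi> z) * indicator {min x y..max x y} z"
      using pos[of z] by (auto simp: indicator_def ennreal_leI split: if_splits)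
  qed
  finally show ?thesis .
qed

text \<open>By injectivity of \<open>a\<close> at most one term of the series is nonzero at a given
  point, so the series is a single summand or zero.\<close>

lemma Delta_part_le:
  assumes inj: "inj a" and pos: "\<And>z. 0 < \<phi> z"
  shows "ennreal \<bar>Delta_part \<phi> a l x\<bar>
    \<le> (\<integral>\<^sup>+i. ennreal \<bar>l i\<bar> * (ennreal (\<phi> (a i)) * indicator {a i} x) \<partial>count_space UNIV)"
proof (cases "x \<in> range a")
  case True
  then obtain j where j: "x = a j" by auto
  have "Delta_part \<phi> a l x = (\<Sum>i\<in>{j}. l i * \<phi> (a i) * indicator {a i} x)"
    unfolding Delta_part_def
    by (rule suminf_finite) (use inj j in \<open>auto simp: indicator_def dest: injD\<close>)
  then have "ennreal \<bar>Delta_part \<phi> a l x\<bar> = ennreal \<bar>l j\<bar> * (ennreal (\<phi> (a j)) * indicator {a j} x)"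
    using pos[of "a j"] by (simp add: j abs_mult ennreal_mult')
  also have "\<dots> \<le> (\<integral>\<^sup>+i. ennreal \<bar>l i\<bar> * (ennreal (\<phi> (a i)) * indicator {a i} x) \<partial>count_space UNIV)"
    by (rule nn_integral_ge_point) simp
  finally show ?thesis .
next
  case False
  then have "indicator {a i} x = (0 :: real)" for i by (auto simp: indicator_def)
  then show ?thesis by (simp add: Delta_part_def)
qed

text \<open>For \<open>x \<noteq> y\<close> an atom equals at most one of the two points, so the two
  single-point indicators add up to at most the indicator of the closed interval, without a factor
  2.\<close>

lemma Delta_part_diff_le:
  assumes inj: "inj a" and pos: "\<And>z. 0 < \<phi> z"
  shows "ennreal \<bar>Delta_part \<phi> a l x - Delta_part \<phi> a l y\<bar>
    \<le> (\<integral>\<^sup>+i. ennreal \<bar>l i\<bar> * (ennreal (\<phi> (a i)) * indicator {min x y..max x y} (a i)) \<partial>count_space UNIV)"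
proof (cases "x = y")
  case False
  let ?f = "\<lambda>x i. ennreal \<bar>l i\<bar> * (ennreal (\<phi> (a i)) * indicator {a i} x)"
  have "ennreal \<bar>Delta_part \<phi> a l x - Delta_part \<phi> a l y\<bar>
      \<le> ennreal (\<bar>Delta_part \<phi> a l x\<bar> + \<bar>Delta_part \<phi> a l y\<bar>)"
    by (intro ennreal_leI) auto
  also have "\<dots> = ennreal \<bar>Delta_part \<phi> a l x\<bar> + ennreal \<bar>Delta_part \<phi> a l y\<bar>"
    by simp
  also have "\<dots> \<le> (\<integral>\<^sup>+i. ?f x i \<partial>count_space UNIV) + (\<integral>\<^sup>+i. ?f y i \<partial>count_space UNIV)"
    by (intro add_mono Delta_part_le inj pos)
  also have "\<dots> = (\<integral>\<^sup>+i. ?f x i + ?f y i \<partial>count_space UNIV)"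
    by (rule nn_integral_add[symmetric]) auto
  also have "\<dots> \<le> (\<integral>\<^sup>+i. ennreal \<bar>l i\<bar> * (ennreal (\<phi> (a i)) * indicator {min x y..max x y} (a i)) \<partial>count_space UNIV)"
    by (intro nn_integral_mono) (use False in \<open>auto simp: indicator_def\<close>)
  finally show ?thesis .
qed simp

lemma borel_measurable_Delta_part [measurable]: "Delta_part \<phi> a l \<in> borel_measurable borel"
  unfolding Delta_part_def[abs_def] by measurable

text \<open>The continuous and the atomic part of \<open>g\<close> are estimated separately by
  \<open>nn_integral_powr_le\<close>. Recombining them costs \<open>2 powr p\<close>, and
  superadditivity of the power merges the two variations.\<close>

lemma (in prob_space) G_class_error_bound:
  fixes X Y :: "'a \<Rightarrow> real"
  assumes [measurable]: "X \<in> borel_measurable M" "Y \<in> borel_measurable M"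
    and [measurable]: "\<phi> \<in> borel_measurable borel" and pos: "\<And>z. 0 < \<phi> z"
    and K: "0 \<le> K" and P: "\<And>z. prob (between_event M X Y z) \<le> K * \<phi> z"
    and p: "1 \<le> p" and g: "g \<in> G_class p \<phi>"
  shows "integrable M (\<lambda>\<omega>. \<bar>g (X \<omega>) - g (Y \<omega>)\<bar> powr p)"
    and "(\<integral>\<omega>. \<bar>g (X \<omega>) - g (Y \<omega>)\<bar> powr p \<partial>M) \<le> 2 powr p * K * V_functional p \<phi> g powr p"
proof -
  define R where "R v = (\<exists>c \<mu> a l. decomposition p \<phi> g c \<mu> a l \<and>
     v = (\<integral>x. \<phi> x powr (1 + 1/p) \<partial>total_variation \<mu>)
       + (\<Sum>i. \<bar>l i\<bar> * \<phi> (a i) powr (1 + 1/p)))" for v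
  \<comment> \<open>Membership of \<open>g\<close> makes the choice in \<open>V_functional\<close>
    meaningful, so its value comes with a decomposition realising it; that decomposition is used
    from here on.\<close>
  have "\<exists>v. R v" using g by (auto simp: G_class_def R_def)
  then have "R (V_functional p \<phi> g)"
    unfolding V_functional_def R_def[symmetric] by (rule someI_ex)
  then obtain c \<mu> a l where dec: "decomposition p \<phi> g c \<mu> a l"
    and V: "V_functional p \<phi> g = (\<integral>x. \<phi> x powr (1 + 1/p) \<partial>total_variation \<mu>)
       + (\<Sum>i. \<bar>l i\<bar> * \<phi> (a i) powr (1 + 1/p))"
    unfolding R_def by blast
  define V1 where "V1 = (\<integral>x. \<phi> x powr (1 + 1/p) \<partial>total_variation \<mu>)"
  define V2 where "V2 = (\<Sum>i. \<bar>l i\<bar> * \<phi> (a i) powr (1 + 1/p))"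
  have \<mu>: "\<mu> \<in> M_class p \<phi>" and inj: "inj a"
    and sum: "summable (\<lambda>i. \<bar>l i\<bar> * \<phi> (a i) powr (1 + 1/p))"
    and gx: "\<And>x. g x = c + g_part \<phi> \<mu> x + Delta_part \<phi> a l x"
    using dec by (auto simp: decomposition_def)
  note [measurable] = borel_measurable_g_part[OF \<mu>]
  have V12: "0 \<le> V1" "0 \<le> V2"
    unfolding V1_def V2_def using sum by (auto intro!: suminf_nonneg)
  define D1 where "D1 \<omega> = \<bar>g_part \<phi> \<mu> (X \<omega>) - g_part \<phi> \<mu> (Y \<omega>)\<bar>" for \<omega>
  define D2 where "D2 \<omega> = \<bar>Delta_part \<phi> a l (X \<omega>) - Delta_part \<phi> a l (Y \<omega>)\<bar>" for \<omega>
  have [measurable]: "D1 \<in> borel_measurable M" "D2 \<in> borel_measurable M"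
    unfolding D1_def[abs_def] D2_def[abs_def] by measurable
  have ind: "indicator {min (X \<omega>) (Y \<omega>)..max (X \<omega>) (Y \<omega>)} z = (indicator (between_event M X Y z) \<omega> :: ennreal)"
    if "\<omega> \<in> space M" for \<omega> z
    using that by (simp add: between_event_def indicator_def)
  have 1: "(\<integral>\<^sup>+\<omega>. ennreal (D1 \<omega> powr p) \<partial>M) \<le> ennreal (K * V1 powr p)"
  proof (rule nn_integral_powr_le[where N="total_variation \<mu>" and \<phi>=\<phi> and H="between_event M X Y"])
    show "sigma_finite_measure (total_variation \<mu>)"
      using \<mu> by (simp add: M_class_def signed_measures_def)
    show "{x \<in> space (total_variation \<mu> \<Otimes>\<^sub>M M). snd x \<in> between_event M X Y (fst x)}
        \<in> sets (total_variation \<mu> \<Otimes>\<^sub>M M)"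
      unfolding between_event_def by (simp add: space_pair_measure) measurable
    have "integrable (total_variation \<mu>) (\<lambda>x. \<phi> x powr (1 + 1/p))"
      using \<mu> pos by (simp add: M_class_def less_imp_le)
    then show "(\<integral>\<^sup>+z. ennreal (\<phi> z powr (1 + 1/p)) \<partial>total_variation \<mu>) \<le> ennreal V1"
      by (subst nn_integral_eq_integral) (auto simp: V1_def)
    show "ennreal (D1 \<omega>) \<le> (\<integral>\<^sup>+z. ennreal (\<phi> z) * indicator (between_event M X Y z) \<omega> \<partial>total_variation \<mu>)"
      if "\<omega> \<in> space M" for \<omega>
      using g_part_diff_le[where x="X \<omega>" and y="Y \<omega>", OF \<mu> _ pos] by (simp add: D1_def ind[OF that])
  qed (use pos P K p V12 in \<open>auto simp: D1_def\<close>)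
  \<comment> \<open>The atoms are indexed by natural numbers: mass \<open>\<bar>l i\<bar>\<close> at
    \<open>i\<close>, with weight \<open>\<phi> (a i)\<close> and crossing level
    \<open>a i\<close>.\<close>
  define N where "N = density (count_space UNIV) (\<lambda>i. ennreal \<bar>l i\<bar>)"
  have 2: "(\<integral>\<^sup>+\<omega>. ennreal (D2 \<omega> powr p) \<partial>M) \<le> ennreal (K * V2 powr p)"
  proof (rule nn_integral_powr_le[where N=N and \<phi>="\<lambda>i. \<phi> (a i)" and H="\<lambda>i. between_event M X Y (a i)"])
    have [measurable_cong, simp]: "sets N = sets (count_space UNIV)" by (simp add: N_def)
    have [simp]: "space N = UNIV" by (simp add: N_def)
    interpret C: sigma_finite_measure "count_space (UNIV :: nat set)"
      by (rule sigma_finite_measure_count_space)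
    show "sigma_finite_measure N"
      unfolding N_def by (subst C.sigma_finite_iff_density_finite) auto
    show "(\<lambda>i. \<phi> (a i)) \<in> borel_measurable N" by measurable
    have [measurable]: "a \<in> borel_measurable N" by measurable
    show "{x \<in> space (N \<Otimes>\<^sub>M M). snd x \<in> between_event M X Y (a (fst x))} \<in> sets (N \<Otimes>\<^sub>M M)"
      unfolding between_event_def by (simp add: space_pair_measure) measurable
    have "(\<integral>\<^sup>+i. ennreal (\<phi> (a i) powr (1 + 1/p)) \<partial>N)
        = (\<integral>\<^sup>+i. ennreal (\<bar>l i\<bar> * \<phi> (a i) powr (1 + 1/p)) \<partial>count_space UNIV)"
      unfolding N_def by (subst nn_integral_density) (auto simp: ennreal_mult')
    also have "\<dots> = ennreal V2"
      unfolding V2_def nn_integral_count_space_nat by (rule suminf_ennreal2) (use sum in auto)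
    finally show "(\<integral>\<^sup>+i. ennreal (\<phi> (a i) powr (1 + 1/p)) \<partial>N) \<le> ennreal V2" by simp
    show "ennreal (D2 \<omega>) \<le> (\<integral>\<^sup>+i. ennreal (\<phi> (a i)) * indicator (between_event M X Y (a i)) \<omega> \<partial>N)"
      if "\<omega> \<in> space M" for \<omega>
      using Delta_part_diff_le[where \<phi>=\<phi> and l=l and x="X \<omega>" and y="Y \<omega>", OF inj pos]
      unfolding N_def by (subst nn_integral_density) (auto simp: D2_def ind[OF that])
  qed (use pos P K p V12 in \<open>auto simp: D2_def\<close>)
  have pt: "\<bar>g (X \<omega>) - g (Y \<omega>)\<bar> powr p \<le> 2 powr p * (D1 \<omega> powr p + D2 \<omega> powr p)" for \<omega>
  proof -
    have "\<bar>g (X \<omega>) - g (Y \<omega>)\<bar> \<le> 2 * max (D1 \<omega>) (D2 \<omega>)"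
      unfolding gx D1_def D2_def by (simp add: max_def abs_if)
    then have "\<bar>g (X \<omega>) - g (Y \<omega>)\<bar> powr p \<le> (2 * max (D1 \<omega>) (D2 \<omega>)) powr p"
      using p by (intro powr_mono2) auto
    also have "\<dots> = 2 powr p * max (D1 \<omega>) (D2 \<omega>) powr p"
      by (rule powr_mult)
    also have "\<dots> \<le> 2 powr p * (D1 \<omega> powr p + D2 \<omega> powr p)"
      by (intro mult_left_mono) (auto simp: max_def)
    finally show ?thesis .
  qed
  \<comment> \<open>Superadditivity for \<open>1 \<le> p\<close>: write \<open>v powr p\<close> as
    \<open>v * v powr (p - 1)\<close> and use that the second factor is increasing.\<close>
  have V_sum: "V1 powr p + V2 powr p \<le> (V1 + V2) powr p"
  proof -
    have q: "v powr p = v * v powr (p - 1)" if "0 \<le> v" for v :: real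
      using powr_add[of v 1 "p - 1"] that by simp
    have "V1 * V1 powr (p - 1) + V2 * V2 powr (p - 1)
        \<le> V1 * (V1 + V2) powr (p - 1) + V2 * (V1 + V2) powr (p - 1)"
      using V12 p by (intro add_mono mult_left_mono powr_mono2) auto
    then show ?thesis using V12 by (simp add: q distrib_right)
  qed
  have "(\<integral>\<^sup>+\<omega>. ennreal (\<bar>g (X \<omega>) - g (Y \<omega>)\<bar> powr p) \<partial>M)
      \<le> (\<integral>\<^sup>+\<omega>. ennreal (2 powr p) * (ennreal (D1 \<omega> powr p) + ennreal (D2 \<omega> powr p)) \<partial>M)"
    using ennreal_leI[OF pt] by (intro nn_integral_mono) (simp add: ennreal_mult')
  also have "\<dots> = ennreal (2 powr p) * ((\<integral>\<^sup>+\<omega>. ennreal (D1 \<omega> powr p) \<partial>M) + (\<integral>\<^sup>+\<omega>. ennreal (D2 \<omega> powr p) \<partial>M))"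
    by (subst nn_integral_cmult) (auto simp: nn_integral_add)
  also have "\<dots> \<le> ennreal (2 powr p) * (ennreal (K * V1 powr p) + ennreal (K * V2 powr p))"
    by (intro mult_left_mono add_mono 1 2) simp
  also have "\<dots> = ennreal (2 powr p * (K * (V1 powr p + V2 powr p)))"
    using K by (simp add: ennreal_mult' distrib_left)
  also have "\<dots> \<le> ennreal (2 powr p * (K * (V1 + V2) powr p))"
    using K V_sum by (intro ennreal_leI mult_left_mono) auto
  also have "\<dots> = ennreal (2 powr p * K * V_functional p \<phi> g powr p)"
    by (simp add: V V1_def V2_def mult.assoc)
  finally have le: "(\<integral>\<^sup>+\<omega>. ennreal (\<bar>g (X \<omega>) - g (Y \<omega>)\<bar> powr p) \<partial>M)
      \<le> ennreal (2 powr p * K * V_functional p \<phi> g powr p)" .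
  have [measurable]: "g \<in> borel_measurable borel"
    unfolding gx[abs_def] by measurable
  show int: "integrable M (\<lambda>\<omega>. \<bar>g (X \<omega>) - g (Y \<omega>)\<bar> powr p)"
    by (rule integrableI_bounded) (use le in \<open>auto intro: le_less_trans\<close>)
  have "ennreal (\<integral>\<omega>. \<bar>g (X \<omega>) - g (Y \<omega>)\<bar> powr p \<partial>M) \<le> ennreal (2 powr p * K * V_functional p \<phi> g powr p)"
    using le by (subst nn_integral_eq_integral[OF int, symmetric]) auto
  then show "(\<integral>\<omega>. \<bar>g (X \<omega>) - g (Y \<omega>)\<bar> powr p \<partial>M) \<le> 2 powr p * K * V_functional p \<phi> g powr p"
    using K by (subst (asm) ennreal_le_iff) auto
qed

subsection \<open>The tail bump function\<close>

lemma bdd_below_tail_moments: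
  "bdd_below ((\<lambda>r. (C r + Lr_norm M r Z) powr (\<theta> * r) / \<bar>z\<bar> powr (\<theta> * r)) ` {1..})"
  by (rule bdd_belowI2[where m=0]) simp

lemma tail_bump0_le_1: "tail_bump0 M Z C \<theta> z \<le> 1"
  by (simp add: tail_bump0_def)

lemma tail_bump0_le:
  assumes "1 \<le> r" "z \<noteq> 0"
  shows "tail_bump0 M Z C \<theta> z \<le> (C r + Lr_norm M r Z) powr (\<theta> * r) / \<bar>z\<bar> powr (\<theta> * r)"
  using cINF_lower[OF bdd_below_tail_moments, of r C M Z \<theta> z] assms
  by (auto simp: tail_bump0_def)

lemma le_tail_bump0:
  assumes "x \<le> 1"
    and "\<And>r. 1 \<le> r \<Longrightarrow> z \<noteq> 0 \<Longrightarrow> x \<le> (C r + Lr_norm M r Z) powr (\<theta> * r) / \<bar>z\<bar> powr (\<theta> * r)"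
  shows "x \<le> tail_bump0 M Z C \<theta> z"
  using assms by (auto simp: tail_bump0_def intro!: cINF_greatest)

text \<open>Every quotient under the infimum decreases in \<open>\<bar>z\<bar>\<close>, and the
  value 1 at zero is the largest possible.\<close>

lemma tail_bump0_antimono:
  assumes "\<bar>z\<bar> \<le> \<bar>w\<bar>" "0 < \<theta>"
  shows "tail_bump0 M Z C \<theta> w \<le> tail_bump0 M Z C \<theta> z"
proof (rule le_tail_bump0)
  fix r :: real assume r: "1 \<le> r" and z: "z \<noteq> 0"
  then have "tail_bump0 M Z C \<theta> w \<le> (C r + Lr_norm M r Z) powr (\<theta> * r) / \<bar>w\<bar> powr (\<theta> * r)"
    using assms by (intro tail_bump0_le) auto
  also have "\<dots> \<le> (C r + Lr_norm M r Z) powr (\<theta> * r) / \<bar>z\<bar> powr (\<theta> * r)"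
    using assms r z by (intro divide_left_mono powr_mono2) auto
  finally show "tail_bump0 M Z C \<theta> w \<le> (C r + Lr_norm M r Z) powr (\<theta> * r) / \<bar>z\<bar> powr (\<theta> * r)" .
qed (rule tail_bump0_le_1)

text \<open>Positivity comes from \<open>\<psi>\<close>, since the infimum may be zero.\<close>

lemma tail_bump_bounds:
  assumes "bump \<psi>"
  shows "0 < tail_bump M Z C \<theta> \<psi> z" "tail_bump M Z C \<theta> \<psi> z \<le> 1"
  using assms tail_bump0_le_1[of M Z C \<theta> z] by (auto simp: tail_bump_def bump_def less_max_iff_disj)

text \<open>As a maximum of two such functions, the tail bump increases on \<open>{..0}\<close> and
  decreases on \<open>{0<..}\<close>; monotone functions are Borel, and the two pieces are
  glued.\<close>

lemma borel_measurable_tail_bump: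
  assumes \<psi>: "bump \<psi>" and \<theta>: "0 < \<theta>"
  shows "tail_bump M Z C \<theta> \<psi> \<in> borel_measurable borel"
proof -
  let ?\<phi> = "tail_bump M Z C \<theta> \<psi>"
  have "mono_on {..0} ?\<phi>"
  proof (rule mono_onI)
    fix x y :: real assume xy: "x \<in> {..0}" "y \<in> {..0}" "x \<le> y"
    then have "\<psi> x \<le> \<psi> y" using \<psi> by (auto simp: bump_def monotone_on_def)
    then show "?\<phi> x \<le> ?\<phi> y"
      unfolding tail_bump_def using xy \<theta> by (intro max.mono tail_bump0_antimono) auto
  qed
  moreover have "mono_on {0<..} (\<lambda>x. - ?\<phi> x)"
  proof (rule mono_onI)
    fix x y :: real assume xy: "x \<in> {0<..}" "y \<in> {0<..}" "x \<le> y"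
    then have "\<psi> y \<le> \<psi> x" using \<psi> by (auto simp: bump_def monotone_on_def)
    then show "- ?\<phi> x \<le> - ?\<phi> y"
      unfolding tail_bump_def neg_le_iff_le using xy \<theta> by (intro max.mono tail_bump0_antimono) auto
  qed
  ultimately have m: "?\<phi> \<in> borel_measurable (restrict_space borel {..0})"
    "?\<phi> \<in> borel_measurable (restrict_space borel {0<..})"
    using borel_measurable_mono_on_fnc[of "{..0}" ?\<phi>]
      borel_measurable_mono_on_fnc[of "{0<..}" "\<lambda>x. - ?\<phi> x"] by auto
  have s: "{x. x \<le> (0::real)} = {..0}" "{x. \<not> x \<le> (0::real)} = {0<..}" by auto
  have "(\<lambda>x. if x \<le> 0 then ?\<phi> x else ?\<phi> x) \<in> borel_measurable borel"
    by (subst measurable_If_restrict_space_iff) (use m s in auto)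
  then show ?thesis by simp
qed

text \<open>Interpolation: \<open>P = P\<^sup>1\<^sup>-\<^sup>\<theta> P\<^sup>\<theta>\<close>, where the first factor supplies the rate (with
  \<open>r = 1/\<theta>\<close>) and the second one the decay in \<open>z\<close>; \<open>3\<^sup>1\<^sup>-\<^sup>\<theta> 2\<^sup>\<theta> \<le> 3\<close>.\<close>

lemma (in prob_space) prob_between_le_tail_bump:
  fixes f :: "real \<Rightarrow> real"
  assumes X: "distributed M lborel X f" and f: "\<And>x. 0 \<le> f x" "\<And>x. f x \<le> D"
    and meas: "X \<in> borel_measurable M" "Y \<in> borel_measurable M"
    and intX: "\<And>r. 1 \<le> r \<Longrightarrow> integrable M (\<lambda>\<omega>. \<bar>X \<omega>\<bar> powr r)"
    and int: "\<And>r. 1 \<le> r \<Longrightarrow> integrable M (\<lambda>\<omega>. \<bar>X \<omega> - Y \<omega>\<bar> powr r)"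
    and C: "\<And>r. 1 \<le> r \<Longrightarrow> Lr_norm M r (\<lambda>\<omega>. X \<omega> - Y \<omega>) \<le> C r"
    and \<theta>: "0 < \<theta>" "\<theta> < 1" and e: "Lr_norm M (1 / \<theta>) (\<lambda>\<omega>. X \<omega> - Y \<omega>) \<le> e"
  shows "prob (between_event M X Y z)
    \<le> 3 * (D * e) powr ((1 - \<theta>) / (1 + \<theta>)) * tail_bump M X C \<theta> \<psi> z"
proof -
  let ?P = "prob (between_event M X Y z)"
  have D: "0 < D" by (rule density_bound_pos[OF X f])
  have r: "1 \<le> 1 / \<theta>" using \<theta> by simp
  \<comment> \<open>The moment order \<open>r = 1 / \<theta>\<close> turns the exponent
    \<open>r / (r + 1)\<close> of the uniform bound into \<open>1 / (1 + \<theta>)\<close>.\<close>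
  have ex: "1 / \<theta> / (1 / \<theta> + 1) = 1 / (1 + \<theta>)" using \<theta> by (simp add: field_simps)
  have "?P \<le> 3 * (D * e) powr (1 / (1 + \<theta>))"
    using prob_between_le[OF X f meas _ int[OF r] e, of z] \<theta> unfolding ex by simp
  then have "?P powr (1 - \<theta>) \<le> (3 * (D * e) powr (1 / (1 + \<theta>))) powr (1 - \<theta>)"
    using \<theta> by (intro powr_mono2) auto
  also have "\<dots> = 3 powr (1 - \<theta>) * (D * e) powr ((1 - \<theta>) / (1 + \<theta>))"
    by (simp add: powr_mult powr_powr)
  finally have 1: "?P powr (1 - \<theta>) \<le> 3 powr (1 - \<theta>) * (D * e) powr ((1 - \<theta>) / (1 + \<theta>))" .
  have le1: "?P powr \<theta> / 2 powr \<theta> \<le> 1"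
    using \<theta> by (auto intro!: powr_mono2 order_trans[OF prob_le_1])
  have "?P powr \<theta> / 2 powr \<theta> \<le> tail_bump0 M X C \<theta> z"
  proof (rule le_tail_bump0)
    fix r :: real assume r: "1 \<le> r" and z: "z \<noteq> 0"
    have nn: "0 \<le> C r + Lr_norm M r X"
      using C[OF r] Lr_norm_nonneg[of M r] order_trans by (metis add_nonneg_nonneg)
    have "?P powr \<theta> \<le> (2 * ((C r + Lr_norm M r X) powr r / \<bar>z\<bar> powr r)) powr \<theta>"
      using prob_between_tail_le[OF meas r intX[OF r] int[OF r] C[OF r] z] \<theta> by (intro powr_mono2) auto
    also have "\<dots> = 2 powr \<theta> * ((C r + Lr_norm M r X) powr (\<theta> * r) / \<bar>z\<bar> powr (\<theta> * r))"
      using nn by (simp add: powr_mult powr_divide powr_powr mult.commute)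
    finally show "?P powr \<theta> / 2 powr \<theta> \<le> (C r + Lr_norm M r X) powr (\<theta> * r) / \<bar>z\<bar> powr (\<theta> * r)"
      by (simp add: field_simps)
  qed (rule le1)
  also have "\<dots> \<le> tail_bump M X C \<theta> \<psi> z" by (simp add: tail_bump_def)
  finally have 2: "?P powr \<theta> \<le> 2 powr \<theta> * tail_bump M X C \<theta> \<psi> z"
    by (simp add: field_simps)
  \<comment> \<open>Here \<open>\<psi>\<close> is arbitrary, so nonnegativity of the tail bump is
    read off from the bound just proved.\<close>
  have "0 \<le> ?P powr \<theta> / 2 powr \<theta>" by simp
  then have nn: "0 \<le> tail_bump M X C \<theta> \<psi> z"
    using 2 by (metis zero_le_mult_iff order_trans powr_ge_zero powr_gt_zero not_le zero_neq_numeral mult_pos_neg)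
  have "?P = ?P powr (1 - \<theta>) * ?P powr \<theta>"
    using powr_add[of ?P "1 - \<theta>" \<theta>] by simp
  also have "\<dots> \<le> (3 powr (1 - \<theta>) * (D * e) powr ((1 - \<theta>) / (1 + \<theta>))) * (2 powr \<theta> * tail_bump M X C \<theta> \<psi> z)"
    by (rule mult_mono[OF 1 2]) auto
  also have "\<dots> = (3 powr (1 - \<theta>) * 2 powr \<theta>) * ((D * e) powr ((1 - \<theta>) / (1 + \<theta>)) * tail_bump M X C \<theta> \<psi> z)"
    by (simp add: mult_ac)
  also have "3 powr (1 - \<theta>) * 2 powr \<theta> \<le> 3 powr (1 - \<theta>) * 3 powr \<theta>"
    using \<theta> by (intro mult_left_mono powr_mono2) auto
  also have "(3::real) powr (1 - \<theta>) * 3 powr \<theta> = 3"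
    by (simp flip: powr_add)
  finally show ?thesis using nn by (simp add: mult_ac mult_left_mono mult_right_mono)
qed

subsection \<open>Discretisation schemes\<close>

lemma time_grid_mono:
  assumes "time_grid T n \<tau>" "i \<le> j" "j \<le> n"
  shows "\<tau> i \<le> \<tau> j"
  using assms(2,3)
proof (induction j rule: dec_induct)
  case (step k)
  then have "\<tau> k < \<tau> (Suc k)" using assms(1) by (simp add: time_grid_def)
  then show ?case using step by simp
qed simp

lemma time_grid_mem:
  assumes "time_grid T n \<tau>" "i \<le> n"
  shows "\<tau> i \<in> {0..T}"
  using time_grid_mono[OF assms(1), of 0 i] time_grid_mono[OF assms(1), of i n] assms
  by (auto simp: time_grid_def)

lemma mesh_pos:
  assumes "time_grid T n \<tau>" "0 < T"
  shows "0 < mesh n \<tau>"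
proof -
  have n: "0 < n" using assms by (cases n) (auto simp: time_grid_def)
  then have "0 < \<bar>\<tau> (Suc 0) - \<tau> 0\<bar>" using assms by (force simp: time_grid_def)
  also have "\<dots> \<le> mesh n \<tau>" unfolding mesh_def using n by (intro Max_ge) auto
  finally show ?thesis .
qed

text \<open>Common to both schemes, with strong order \<open>\<gamma>\<close>: the interpolated
  crossing bound is used with \<open>e = C (1 / \<theta>) * mesh n \<tau> powr \<gamma>\<close>, and
  its exponent \<open>\<eta>\<close> produces the rate \<open>\<gamma> * \<eta>\<close>.\<close>

lemma (in prob_space) scheme_error_bound:
  fixes f :: "real \<Rightarrow> real"
  assumes T: "0 < T" and X: "distributed M lborel X f" and f: "\<forall>x. 0 \<le> f x" "bdd_above (range f)"
    and Y: "Y \<tau> n \<in> borel_measurable M"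
    and intX: "\<And>r. 1 \<le> r \<Longrightarrow> integrable M (\<lambda>\<omega>. \<bar>X \<omega>\<bar> powr r)"
    and sec: "strong_error_constants M T X Y \<gamma> C" and \<gamma>: "0 \<le> \<gamma>"
    and \<theta>: "0 < \<theta>" "\<theta> < 1" and \<psi>: "bump \<psi>"
    and grid: "time_grid T n \<tau>"
    and le: "mesh n \<tau> \<le> 1 \<or> (\<forall>r\<ge>1. Lr_norm M r (\<lambda>\<omega>. X \<omega> - Y \<tau> n \<omega>) \<le> C r)"
    and p: "1 \<le> p" and g: "g \<in> G_class p (tail_bump M X C \<theta> \<psi>)"
    and \<eta>: "\<eta> = (1 - \<theta>) / (1 + \<theta>)"
  shows "integrable M (\<lambda>\<omega>. \<bar>g (X \<omega>) - g (Y \<tau> n \<omega>)\<bar> powr p) \<and>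
    (\<integral>\<omega>. \<bar>g (X \<omega>) - g (Y \<tau> n \<omega>)\<bar> powr p \<partial>M)
      \<le> 3 * 2 powr p * (SUP x. f x) powr \<eta> * V_functional p (tail_bump M X C \<theta> \<psi>) g powr p
         * C (1 / \<theta>) powr \<eta> * mesh n \<tau> powr (\<gamma> * \<eta>)"
proof -
  let ?\<phi> = "tail_bump M X C \<theta> \<psi>" and ?D = "SUP x. f x" and ?m = "mesh n \<tau>"
  have m: "0 < ?m" by (rule mesh_pos[OF grid T])
  have Xm: "X \<in> borel_measurable M" using distributed_measurable[OF X] by simp
  have fD: "f x \<le> ?D" for x using f(2) by (simp add: cSUP_upper)
  have D: "0 < ?D" by (rule density_bound_pos[OF X f(1)[rule_format] fD])
  have int: "integrable M (\<lambda>\<omega>. \<bar>X \<omega> - Y \<tau> n \<omega>\<bar> powr r)"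
    and err: "Lr_norm M r (\<lambda>\<omega>. X \<omega> - Y \<tau> n \<omega>) \<le> C r * ?m powr \<gamma>" if "1 \<le> r" for r
    using sec grid that by (auto simp: strong_error_constants_def)
  have C0: "0 \<le> C r" if "1 \<le> r" for r
    using order_trans[OF Lr_norm_nonneg err[OF that]] m by (simp add: zero_le_mult_iff)
  \<comment> \<open>The tail bump contains \<open>C r\<close> without a power of the mesh, so the
    error norm itself has to be at most \<open>C r\<close>; this is what the hypothesis
    \<open>le\<close> provides.\<close>
  have C: "Lr_norm M r (\<lambda>\<omega>. X \<omega> - Y \<tau> n \<omega>) \<le> C r" if r: "1 \<le> r" for r
    using le
  proof
    assume "?m \<le> 1"
    then have "C r * ?m powr \<gamma> \<le> C r * 1"
      using m \<gamma> C0[OF r] by (intro mult_left_mono powr_le1) auto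
    then show ?thesis using err[OF r] by simp
  qed (use r in blast)
  have r: "1 \<le> 1 / \<theta>" using \<theta> by simp
  let ?K = "3 * (?D * (C (1 / \<theta>) * ?m powr \<gamma>)) powr \<eta>"
  have P: "prob (between_event M X (Y \<tau> n) z) \<le> ?K * ?\<phi> z" for z
    unfolding \<eta> by (rule prob_between_le_tail_bump[OF X f(1)[rule_format] fD Xm Y intX int C \<theta> err[OF r]])
  have K: "?K = 3 * ?D powr \<eta> * C (1 / \<theta>) powr \<eta> * ?m powr (\<gamma> * \<eta>)"
    using D C0[OF r] by (simp add: powr_mult powr_powr)
  note bound = G_class_error_bound[OF Xm Y borel_measurable_tail_bump[OF \<psi> \<theta>(1)]
      tail_bump_bounds(1)[OF \<psi>] _ P p g]
  have "0 \<le> ?K" by simp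
  from bound[OF this] show ?thesis unfolding K by (simp add: mult_ac)
qed

section \<open>Measurability of the schemes and moments of the solution\<close>

lemma admissible_coeff_measurable:
  assumes "admissible_coeff T K \<alpha> f" "t \<in> {0..T}"
  shows "f t \<in> borel_measurable borel" "deriv (f t) \<in> borel_measurable borel"
proof -
  have c: "continuous_on ({0..T} \<times> UNIV) (\<lambda>(t, x). f t x)"
    "continuous_on ({0..T} \<times> UNIV) (\<lambda>(t, x). deriv (f t) x)"
    using assms by (auto simp: admissible_coeff_def C01_on_def)
  have p: "continuous_on UNIV (\<lambda>x. (t, x))" "(\<lambda>x. (t, x)) ` UNIV \<subseteq> {0..T} \<times> UNIV"
    using assms(2) by (auto intro!: continuous_intros)
  show "f t \<in> borel_measurable borel" "deriv (f t) \<in> borel_measurable borel"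
    using continuous_on_compose2[OF c(1) p] continuous_on_compose2[OF c(2) p]
    by (auto intro: borel_measurable_continuous_onI)
qed

lemma euler_scheme_measurable:
  assumes "\<And>t. t \<in> {0..T} \<Longrightarrow> W t \<in> borel_measurable M"
    and ad: "admissible_coeff T K \<alpha> \<sigma>" "admissible_coeff T K \<alpha> b"
    and grid: "time_grid T n \<tau>" and "i \<le> n"
  shows "euler_scheme \<sigma> b x0 W \<tau> i \<in> borel_measurable M"
  using \<open>i \<le> n\<close>
proof (induction i)
  case 0
  have "euler_scheme \<sigma> b x0 W \<tau> 0 = (\<lambda>_. x0)" by (rule ext) simp
  then show ?case by simp
next
  case (Suc i)
  then have t: "\<tau> i \<in> {0..T}" "\<tau> (Suc i) \<in> {0..T}"
    using time_grid_mem[OF grid] by auto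
  note [measurable] = assms(1)[OF t(1)] assms(1)[OF t(2)] admissible_coeff_measurable[OF ad(1) t(1)]
    admissible_coeff_measurable[OF ad(2) t(1)]
  have [measurable]: "euler_scheme \<sigma> b x0 W \<tau> i \<in> borel_measurable M" using Suc by simp
  show ?case unfolding euler_scheme.simps Let_def by measurable
qed

lemma milstein_scheme_measurable:
  assumes "\<And>t. t \<in> {0..T} \<Longrightarrow> W t \<in> borel_measurable M"
    and ad: "admissible_coeff T K \<alpha> \<sigma>" "admissible_coeff T K \<alpha> b"
    and grid: "time_grid T n \<tau>" and "i \<le> n"
  shows "milstein_scheme \<sigma> b x0 W \<tau> i \<in> borel_measurable M"
  using \<open>i \<le> n\<close>
proof (induction i)
  case 0
  have "milstein_scheme \<sigma> b x0 W \<tau> 0 = (\<lambda>_. x0)" by (rule ext) simp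
  then show ?case by simp
next
  case (Suc i)
  then have t: "\<tau> i \<in> {0..T}" "\<tau> (Suc i) \<in> {0..T}"
    using time_grid_mem[OF grid] by auto
  note [measurable] = assms(1)[OF t(1)] assms(1)[OF t(2)] admissible_coeff_measurable[OF ad(1) t(1)]
    admissible_coeff_measurable[OF ad(2) t(1)]
  have [measurable]: "milstein_scheme \<sigma> b x0 W \<tau> i \<in> borel_measurable M" using Suc by simp
  show ?case unfolding milstein_scheme.simps Let_def by measurable
qed

text \<open>A real power is dominated by 1 plus the power with exponent rounded up to a natural
  number, and natural moments of a Gaussian are finite.\<close>

lemma (in prob_space) normal_abs_powr_integrable:
  assumes G: "distributed M lborel G (normal_density 0 s)" and s: "0 < s" and r: "0 \<le> r"
  shows "integrable M (\<lambda>\<omega>. \<bar>G \<omega>\<bar> powr r)"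
proof -
  have [measurable]: "G \<in> borel_measurable M" using distributed_measurable[OF G] by simp
  define k where "k = nat \<lceil>r\<rceil>"
  have "integrable lborel (\<lambda>x. normal_density 0 s x * \<bar>x\<bar> ^ k)"
    using integrable_normal_moment_abs[OF s, of 0 k] by simp
  then have k: "integrable M (\<lambda>\<omega>. \<bar>G \<omega>\<bar> ^ k)"
    by (subst (asm) distributed_integrable[OF G]) auto
  have le: "\<bar>x\<bar> powr r \<le> 1 + \<bar>x\<bar> ^ k" for x :: real
  proof (cases "\<bar>x\<bar> \<le> 1")
    case True
    then have "\<bar>x\<bar> powr r \<le> 1" using r by (intro powr_le1) auto
    then show ?thesis by (simp add: add_increasing2)
  next
    case False
    then have "\<bar>x\<bar> powr r \<le> \<bar>x\<bar> powr real k"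
      using r by (intro powr_mono) (auto simp: k_def)
    then show ?thesis using False by (simp add: powr_realpow)
  qed
  show ?thesis
    by (rule Bochner_Integration.integrable_bound[OF Bochner_Integration.integrable_add[OF integrable_const[of 1] k]])
      (use le in auto)
qed

text \<open>The moment of order \<open>r\<close> of the square is the moment of order
  \<open>2 * r\<close> of \<open>G\<close>. The signs below only bring the sums into the shape of
  differences.\<close>

lemma (in prob_space) integrable_quadratic_powr:
  fixes G :: "'a \<Rightarrow> real"
  assumes [measurable]: "G \<in> borel_measurable M" and int: "\<And>r. 1 \<le> r \<Longrightarrow> integrable M (\<lambda>\<omega>. \<bar>G \<omega>\<bar> powr r)"
    and r: "1 \<le> r"
  shows "integrable M (\<lambda>\<omega>. \<bar>u + v * G \<omega> + w * (G \<omega>)\<^sup>2\<bar> powr r)"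
proof -
  have G: "integrable M (\<lambda>\<omega>. \<bar>c * G \<omega>\<bar> powr r)" for c
    using int[OF r] by (simp add: abs_mult powr_mult)
  have "\<bar>(G \<omega>)\<^sup>2\<bar> powr r = \<bar>G \<omega>\<bar> powr (2 * r)" for \<omega>
    using powr_powr[of "\<bar>G \<omega>\<bar>" 2 r] by simp
  then have G2: "integrable M (\<lambda>\<omega>. \<bar>c * (G \<omega>)\<^sup>2\<bar> powr r)" for c
    using int[of "2 * r"] r by (simp add: abs_mult powr_mult)
  have 1: "integrable M (\<lambda>\<omega>. \<bar>u - (- v) * G \<omega>\<bar> powr r)"
    by (rule integrable_abs_diff_powr[OF _ _ r _ G]) auto
  have "integrable M (\<lambda>\<omega>. \<bar>(u - (- v) * G \<omega>) - (- w) * (G \<omega>)\<^sup>2\<bar> powr r)"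
    by (rule integrable_abs_diff_powr[OF _ _ r 1 G2]) auto
  then show ?thesis by simp
qed

text \<open>A single time step is a quadratic polynomial in a Gaussian variable, so the strong error
  estimate for the trivial grid already yields the moments of \<open>X\<^sub>T\<close>.\<close>

lemma (in prob_space) moments_of_strong_error:
  assumes T: "0 < T" and BM: "brownian_motion_on M T W"
    and [measurable]: "X \<in> borel_measurable M"
    and sec: "strong_error_constants M T X Y \<gamma> C"
    and Y: "\<And>\<omega>. Y (\<lambda>i. real i * T) 1 \<omega> = u + v * (W T \<omega> - W 0 \<omega>) + w * (W T \<omega> - W 0 \<omega>)\<^sup>2"
    and r: "1 \<le> r"
  shows "integrable M (\<lambda>\<omega>. \<bar>X \<omega>\<bar> powr r)"
proof -
  define G where "G \<omega> = W T \<omega> - W 0 \<omega>" for \<omega>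
  have "distributed M lborel G (normal_density 0 (sqrt T))"
  proof -
    have "\<forall>s t. 0 \<le> s \<longrightarrow> s < t \<longrightarrow> t \<le> T \<longrightarrow>
        distributed M lborel (\<lambda>\<omega>. W t \<omega> - W s \<omega>) (normal_density 0 (sqrt (t - s)))"
      using BM unfolding brownian_motion_on_def by (elim conjE)
    from this[rule_format, of 0 T] show ?thesis using T by (simp add: G_def[abs_def])
  qed
  note G = distributed_measurable[OF this] normal_abs_powr_integrable[OF this]
  have [measurable]: "G \<in> borel_measurable M" using G(1) by simp
  have grid: "time_grid T 1 (\<lambda>i. real i * T)" using T by (simp add: time_grid_def)
  have "integrable M (\<lambda>\<omega>. \<bar>X \<omega> - Y (\<lambda>i. real i * T) 1 \<omega>\<bar> powr r)"
    using sec grid r by (auto simp: strong_error_constants_def)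
  then have 1: "integrable M (\<lambda>\<omega>. \<bar>X \<omega> - (u + v * G \<omega> + w * (G \<omega>)\<^sup>2)\<bar> powr r)"
    unfolding Y G_def .
  have 2: "integrable M (\<lambda>\<omega>. \<bar>u + v * G \<omega> + w * (G \<omega>)\<^sup>2\<bar> powr r)"
    by (rule integrable_quadratic_powr[OF _ _ r]) (use G T in auto)
  \<comment> \<open>\<open>X\<close> is the difference of the error \<open>X - Y\<close> and of
    \<open>- Y\<close>, whose moments are both finite.\<close>
  have "integrable M (\<lambda>\<omega>. \<bar>- (u + v * G \<omega> + w * (G \<omega>)\<^sup>2)\<bar> powr r)"
    unfolding abs_minus_cancel by (rule 2)
  from integrable_abs_diff_powr[OF _ _ r 1 this] show ?thesis by simp
qed

text \<open>The vanishing quadratic term gives the Euler step the shape shared with the Milstein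
  step.\<close>

lemma euler_scheme_one_step:
  "euler_scheme \<sigma> b x0 W (\<lambda>i. real i * T) 1 \<omega>
    = (x0 + b 0 x0 * T) + \<sigma> 0 x0 * (W T \<omega> - W 0 \<omega>) + 0 * (W T \<omega> - W 0 \<omega>)\<^sup>2"
  by (simp add: Let_def)

lemma milstein_scheme_one_step:
  "milstein_scheme \<sigma> b x0 W (\<lambda>i. real i * T) 1 \<omega>
    = (x0 + b 0 x0 * T - 1/2 * \<sigma> 0 x0 * deriv (\<sigma> 0) x0 * T) + \<sigma> 0 x0 * (W T \<omega> - W 0 \<omega>)
      + (1/2 * \<sigma> 0 x0 * deriv (\<sigma> 0) x0) * (W T \<omega> - W 0 \<omega>)\<^sup>2"
  by (simp add: Let_def algebra_simps)

subsection \<open>Polynomials\<close>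

text \<open>A single index \<open>r\<close> with \<open>\<theta> * r \<ge> k + 1\<close> suffices:
  the infimum is at most its quotient, which decays one order faster than
  \<open>\<bar>z\<bar> ^ k\<close> grows.\<close>

lemma rapidly_decaying_tail_bump0:
  assumes "0 < \<theta>"
  shows "rapidly_decaying (tail_bump0 M Z C \<theta>)"
  unfolding rapidly_decaying_def
proof
  fix k :: nat
  define r where "r = max 1 ((real k + 1) / \<theta>)"
  define a where "a = (C r + Lr_norm M r Z) powr (\<theta> * r)"
  have r: "1 \<le> r" "real k + 1 \<le> \<theta> * r"
    using assms by (auto simp: r_def max_def field_simps)
  have inf: "eventually (\<lambda>z::real. 1 \<le> \<bar>z\<bar>) at_infinity"
    by (auto simp: eventually_at_infinity)
  have "((\<lambda>z. inverse (\<bar>z\<bar> :: real)) \<longlongrightarrow> 0) at_infinity"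
    using tendsto_inverse_0[where 'a=real] tendsto_rabs_zero by fastforce
  then have lim: "((\<lambda>z. a * inverse \<bar>z\<bar>) \<longlongrightarrow> a * 0) (at_infinity :: real filter)"
    by (intro tendsto_intros)
  have nn: "0 \<le> tail_bump0 M Z C \<theta> z" for z
    by (rule le_tail_bump0) auto
  have ev: "\<bar>z\<bar> ^ k * tail_bump0 M Z C \<theta> z \<le> a * inverse \<bar>z\<bar>" if z: "1 \<le> \<bar>z\<bar>" for z
  proof -
    have "tail_bump0 M Z C \<theta> z \<le> a / \<bar>z\<bar> powr (\<theta> * r)"
      unfolding a_def by (rule tail_bump0_le) (use r z in auto)
    also have "\<dots> \<le> a / \<bar>z\<bar> powr (real k + 1)"
      using r z by (intro divide_left_mono powr_mono) (auto simp: a_def)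
    also have "\<bar>z\<bar> powr (real k + 1) = \<bar>z\<bar> ^ k * \<bar>z\<bar>"
      using z by (simp add: powr_add powr_realpow)
    finally have "\<bar>z\<bar> ^ k * tail_bump0 M Z C \<theta> z \<le> \<bar>z\<bar> ^ k * (a / (\<bar>z\<bar> ^ k * \<bar>z\<bar>))"
      by (intro mult_left_mono) auto
    then show ?thesis using z by (simp add: field_simps split: if_splits)
  qed
  show "((\<lambda>z. \<bar>z\<bar> ^ k * tail_bump0 M Z C \<theta> z) \<longlongrightarrow> 0) at_infinity"
  proof (rule tendsto_sandwich[OF _ _ tendsto_const])
    show "((\<lambda>z. a * inverse \<bar>z\<bar>) \<longlongrightarrow> 0) (at_infinity :: real filter)" using lim by simp
    show "eventually (\<lambda>z. 0 \<le> \<bar>z\<bar> ^ k * tail_bump0 M Z C \<theta> z) at_infinity"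
      using nn by (intro always_eventually) auto
    show "eventually (\<lambda>z. \<bar>z\<bar> ^ k * tail_bump0 M Z C \<theta> z \<le> a * inverse \<bar>z\<bar>) at_infinity"
      using inf by eventually_elim (rule ev)
  qed
qed

lemma rapidly_decaying_tail_bump:
  assumes "0 < \<theta>" "rapidly_decaying \<psi>"
  shows "rapidly_decaying (tail_bump M Z C \<theta> \<psi>)"
  unfolding rapidly_decaying_def
proof
  fix k :: nat
  have "((\<lambda>z. max (\<bar>z\<bar> ^ k * tail_bump0 M Z C \<theta> z) (\<bar>z\<bar> ^ k * \<psi> z)) \<longlongrightarrow> max 0 0) at_infinity"
    using assms(2) rapidly_decaying_tail_bump0[OF assms(1), of M Z C]
    unfolding rapidly_decaying_def by (intro tendsto_max) auto
  also have "(\<lambda>z. max (\<bar>z\<bar> ^ k * tail_bump0 M Z C \<theta> z) (\<bar>z\<bar> ^ k * \<psi> z)) = (\<lambda>z. \<bar>z\<bar> ^ k * tail_bump M Z C \<theta> \<psi> z)"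
    by (rule ext) (simp add: tail_bump_def max_mult_distrib_left)
  finally show "((\<lambda>z. \<bar>z\<bar> ^ k * tail_bump M Z C \<theta> \<psi> z) \<longlongrightarrow> 0) at_infinity" by simp
qed

lemma rapidly_decaying_bound:
  assumes \<phi>: "rapidly_decaying \<phi>" "\<And>z. 0 \<le> \<phi> z" "\<And>z. \<phi> z \<le> 1"
  obtains B where "0 \<le> B" "\<And>z. (1 + z\<^sup>2) ^ k * \<phi> z \<le> B"
proof -
  have "eventually (\<lambda>z. \<bar>z\<bar> ^ (2 * k) * \<phi> z < 1) at_infinity"
    using \<phi>(1) by (auto simp: rapidly_decaying_def intro: order_tendstoD)
  then obtain b where b: "\<And>z. b \<le> \<bar>z\<bar> \<Longrightarrow> \<bar>z\<bar> ^ (2 * k) * \<phi> z < 1"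
    by (auto simp: eventually_at_infinity)
  define b' where "b' = max 1 b"
  \<comment> \<open>The first constant serves large \<open>z\<close>, where
    \<open>1 + z^2 \<le> 2 * z^2\<close> and the limit applies; the second one serves
    \<open>\<bar>z\<bar> < b'\<close>, where \<open>\<phi> \<le> 1\<close> is enough.\<close>
  let ?B = "max (2 ^ k) ((1 + b'\<^sup>2) ^ k)"
  show ?thesis
  proof (rule that[of ?B])
    fix z
    show "(1 + z\<^sup>2) ^ k * \<phi> z \<le> ?B"
    proof (cases "b' \<le> \<bar>z\<bar>")
      case True
      have "1 \<le> \<bar>z\<bar>" using True by (simp add: b'_def)
      then have "1 \<le> z\<^sup>2" using one_le_power[of "\<bar>z\<bar>" 2] by simp
      then have "(1 + z\<^sup>2) ^ k \<le> (2 * z\<^sup>2) ^ k" by (intro power_mono) auto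
      also have "\<dots> = 2 ^ k * \<bar>z\<bar> ^ (2 * k)" by (simp add: power_mult_distrib power_mult)
      finally have "(1 + z\<^sup>2) ^ k * \<phi> z \<le> 2 ^ k * \<bar>z\<bar> ^ (2 * k) * \<phi> z"
        by (intro mult_right_mono \<phi>)
      also have "\<dots> \<le> 2 ^ k * 1"
        unfolding mult.assoc using b[of z] True by (intro mult_left_mono) (auto simp: b'_def)
      finally show ?thesis by simp
    next
      case False
      then have "z\<^sup>2 \<le> b'\<^sup>2" by (intro abs_le_square_iff[THEN iffD1]) auto
      then have "(1 + z\<^sup>2) ^ k * \<phi> z \<le> (1 + b'\<^sup>2) ^ k * 1"
        by (intro mult_mono power_mono \<phi>) auto
      then show ?thesis by simp
    qed
  qed (simp add: le_max_iff_disj)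
qed

text \<open>Horner's scheme together with \<open>\<bar>z\<bar> \<le> 1 + z^2\<close>. Powers of
  \<open>1 + z^2\<close> are at least 1 everywhere and match the integrable majorant used
  next.\<close>

lemma poly_growth:
  fixes q :: "real poly"
  obtains A m where "0 \<le> A" "\<And>z. \<bar>poly q z\<bar> \<le> A * (1 + z\<^sup>2) ^ m"
proof -
  have "\<exists>A m. 0 \<le> A \<and> (\<forall>z. \<bar>poly q z\<bar> \<le> A * (1 + z\<^sup>2) ^ m)"
  proof (induction q)
    case (pCons c q)
    then obtain A m where A: "0 \<le> A" "\<And>z. \<bar>poly q z\<bar> \<le> A * (1 + z\<^sup>2) ^ m" by blast
    have "\<bar>poly (pCons c q) z\<bar> \<le> (\<bar>c\<bar> + A) * (1 + z\<^sup>2) ^ Suc m" for z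
    proof -
      have z: "\<bar>z\<bar> \<le> 1 + z\<^sup>2"
        using sum_power2_ge_zero[of "\<bar>z\<bar> - 1" 0] by (simp add: power2_eq_square algebra_simps; smt (verit) mult_nonneg_nonneg)
      have "\<bar>poly (pCons c q) z\<bar> \<le> \<bar>c\<bar> * 1 + \<bar>z\<bar> * \<bar>poly q z\<bar>"
        using abs_triangle_ineq[of c "z * poly q z"] by (simp add: abs_mult)
      also have "\<dots> \<le> \<bar>c\<bar> * (1 + z\<^sup>2) ^ Suc m + (1 + z\<^sup>2) * (A * (1 + z\<^sup>2) ^ m)"
        by (intro add_mono mult_mono z A mult_left_mono one_le_power) auto
      finally show ?thesis by (simp add: algebra_simps)
    qed
    then show ?case using A(1) by (intro exI[of _ "\<bar>c\<bar> + A"] exI[of _ "Suc m"]) auto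
  qed (auto intro: exI[of _ 0])
  then show ?thesis using that by blast
qed

lemma integrable_poly_bump_powr:
  fixes q :: "real poly"
  assumes \<phi>: "rapidly_decaying \<phi>" "\<And>z. 0 \<le> \<phi> z" "\<And>z. \<phi> z \<le> 1"
    and [measurable]: "\<phi> \<in> borel_measurable borel" and p: "1 \<le> p"
  shows "integrable lborel (\<lambda>z. \<bar>poly q z\<bar> * \<phi> z powr (1/p))"
proof -
  obtain A m where A: "0 \<le> A" "\<And>z. \<bar>poly q z\<bar> \<le> A * (1 + z\<^sup>2) ^ m"
    by (rule poly_growth[of q]) blast
  \<comment> \<open>Taking the root of order \<open>p\<close> divides the decay exponent by
    \<open>p\<close>; this \<open>k\<close> still leaves \<open>m + 1\<close> powers of
    \<open>1 + z^2\<close>, namely \<open>m\<close> for the polynomial and one for the integrable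
    majorant.\<close>
  define k where "k = nat \<lceil>p * real (Suc m)\<rceil>"
  obtain B where B: "0 \<le> B" "\<And>z. (1 + z\<^sup>2) ^ k * \<phi> z \<le> B"
    by (rule rapidly_decaying_bound[OF \<phi>, of k]) blast
  have k: "real (Suc m) \<le> real k * (1/p)"
  proof -
    have "p * real (Suc m) \<le> real k" unfolding k_def by linarith
    then show ?thesis using p by (simp add: field_simps)
  qed
  have [measurable]: "poly q \<in> borel_measurable borel"
    by (intro borel_measurable_continuous_onI continuous_intros)
  have bound: "\<bar>poly q z\<bar> * \<phi> z powr (1/p) \<le> A * B powr (1/p) * inverse (1 + z\<^sup>2)" for z
  proof -
    have s: "1 \<le> 1 + z\<^sup>2" by simp
    have pos: "0 < 1 + z\<^sup>2" by (rule less_le_trans[OF _ s]) simp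
    have "(1 + z\<^sup>2) ^ Suc m \<le> (1 + z\<^sup>2) powr (real k * (1/p))"
      using powr_mono[OF k s] pos powr_realpow[OF pos, of "Suc m"] by simp
    also have "\<dots> = ((1 + z\<^sup>2) ^ k) powr (1/p)"
      using powr_powr[of "1 + z\<^sup>2" "real k" "1/p"] powr_realpow[OF pos, of k] by simp
    finally have "(1 + z\<^sup>2) ^ Suc m * \<phi> z powr (1/p) \<le> ((1 + z\<^sup>2) ^ k) powr (1/p) * \<phi> z powr (1/p)"
      by (intro mult_right_mono) auto
    also have "\<dots> = ((1 + z\<^sup>2) ^ k * \<phi> z) powr (1/p)" by (simp add: powr_mult)
    also have "\<dots> \<le> B powr (1/p)" using p \<phi>(2)[of z] pos B by (intro powr_mono2) auto
    finally have *: "(1 + z\<^sup>2) ^ m * \<phi> z powr (1/p) \<le> B powr (1/p) * inverse (1 + z\<^sup>2)"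
      using pos by (simp add: field_simps)
    have "\<bar>poly q z\<bar> * \<phi> z powr (1/p) \<le> A * ((1 + z\<^sup>2) ^ m * \<phi> z powr (1/p))"
      unfolding mult.assoc[symmetric] by (intro mult_right_mono A) auto
    also have "\<dots> \<le> A * (B powr (1/p) * inverse (1 + z\<^sup>2))"
      by (intro mult_left_mono * A)
    finally show ?thesis by (simp add: mult.assoc)
  qed
  have "integrable lborel (\<lambda>z::real. inverse (1 + z\<^sup>2))"
    using integrable_inverse_1_plus_square by (simp add: set_integrable_def)
  then have i: "integrable lborel (\<lambda>z::real. A * B powr (1/p) * inverse (1 + z\<^sup>2))" by simp
  show ?thesis
  proof (rule Bochner_Integration.integrable_bound[OF i])
    show "AE z in lborel. norm (\<bar>poly q z\<bar> * \<phi> z powr (1/p)) \<le> norm (A * B powr (1/p) * inverse (1 + z\<^sup>2))"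
      using bound by (intro AE_I2) (smt (verit) abs_ge_zero mult_nonneg_nonneg powr_ge_zero real_norm_def)
  qed measurable
qed

lemma poly_in_G_class:
  fixes q :: "real poly"
  assumes rd: "rapidly_decaying \<phi>" and pos: "\<And>z. 0 < \<phi> z" and le1: "\<And>z. \<phi> z \<le> 1"
    and [measurable]: "\<phi> \<in> borel_measurable borel" and p: "1 \<le> p"
  shows "poly q \<in> G_class p \<phi>"
proof -
  define d where "d = poly (pderiv q)"
  have [measurable]: "d \<in> borel_measurable borel"
    unfolding d_def by (intro borel_measurable_continuous_onI continuous_intros)
  define h where "h z = sgn z * d z / \<phi> z" for z
  have [measurable]: "h \<in> borel_measurable borel"
    unfolding h_def[abs_def] by measurable
  \<comment> \<open>\<open>ennreal\<close> sends negative reals to 0, so the two densities are the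
    positive and the negative part of \<open>h\<close>.\<close>
  define \<mu> :: signed_measure where
    "\<mu> = (density lborel (\<lambda>z. ennreal (h z)), density lborel (\<lambda>z. ennreal (- h z)))"
  have s: "sets (fst \<mu>) = sets borel" "sets (snd \<mu>) = sets borel" by (simp_all add: \<mu>_def)
  have TV: "total_variation \<mu> = density lborel (\<lambda>z. ennreal \<bar>h z\<bar>)"
  proof (rule measure_eqI)
    fix A assume "A \<in> sets (total_variation \<mu>)"
    then have [measurable]: "A \<in> sets borel" by simp
    have "emeasure (total_variation \<mu>) A
        = emeasure (density lborel (\<lambda>z. ennreal (h z) + ennreal (- h z))) A"
      unfolding emeasure_total_variation[OF s \<open>A \<in> sets borel\<close>] by (simp add: \<mu>_def emeasure_density_add)
    also have "(\<lambda>z. ennreal (h z) + ennreal (- h z)) = (\<lambda>z. ennreal \<bar>h z\<bar>)"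
      by (rule ext) (auto simp: abs_if ennreal_neg)
    finally show "emeasure (total_variation \<mu>) A = emeasure (density lborel (\<lambda>z. ennreal \<bar>h z\<bar>)) A" .
  qed simp
  have "\<mu> \<in> signed_measures"
    unfolding signed_measures_def
  proof (intro CollectI conjI s bexI[of _ "{z. 0 < h z}"])
    show "emeasure (fst \<mu>) (- {z. 0 < h z}) = 0" "emeasure (snd \<mu>) {z. 0 < h z} = 0"
      unfolding \<mu>_def fst_conv snd_conv
      by (subst emeasure_density; (subst nn_integral_0_iff_AE)?; auto simp: indicator_def ennreal_neg)+
    show "sigma_finite_measure (total_variation \<mu>)"
      unfolding TV by (subst sigma_finite_measure.sigma_finite_iff_density_finite[OF sigma_finite_lborel]) auto
  qed measurable
  have hphi: "\<bar>h z\<bar> * \<phi> z = \<bar>sgn z * d z\<bar>" for z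
    using pos[of z] by (simp add: h_def abs_mult)
  have loc: "set_integrable lborel K (\<lambda>z. d z)" if "compact K" for K
    unfolding d_def set_integrable_def by (intro borel_integrable_compact that continuous_intros)
  have "\<mu> \<in> M_class p \<phi>"
    unfolding M_class_def
  proof (intro CollectI conjI allI impI)
    fix K :: "real set" assume K: "compact K"
    then have [measurable]: "K \<in> sets borel" by (rule borel_compact)
    show "set_integrable (total_variation \<mu>) K \<phi>"
      unfolding set_integrable_def TV
    proof (subst integrable_density)
      show "integrable lborel (\<lambda>x. \<bar>h x\<bar> *\<^sub>R indicat_real K x *\<^sub>R \<phi> x)"
      proof (rule Bochner_Integration.integrable_bound[OF loc[OF K, unfolded set_integrable_def]])
        show "AE x in lborel. norm (\<bar>h x\<bar> *\<^sub>R indicat_real K x *\<^sub>R \<phi> x) \<le> norm (indicat_real K x *\<^sub>R d x)"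
        proof (rule AE_I2)
          fix x
          have "norm (\<bar>h x\<bar> *\<^sub>R indicat_real K x *\<^sub>R \<phi> x) = indicat_real K x * (\<bar>h x\<bar> * \<phi> x)"
            using pos[of x] by (simp add: abs_mult)
          also have "\<dots> \<le> indicat_real K x * \<bar>d x\<bar>"
            unfolding hphi by (intro mult_left_mono) (auto simp: abs_mult sgn_if)
          finally show "norm (\<bar>h x\<bar> *\<^sub>R indicat_real K x *\<^sub>R \<phi> x) \<le> norm (indicat_real K x *\<^sub>R d x)"
            by (simp add: abs_mult)
        qed
      qed measurable
    qed auto
  next
    show "integrable (total_variation \<mu>) (\<lambda>x. \<bar>\<phi> x\<bar> powr (1 + 1/p))"
      unfolding TV
    proof (subst integrable_density)
      \<comment> \<open>One factor \<open>\<phi>\<close> cancels the denominator of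
        \<open>h\<close>, which leaves the derivative times \<open>\<phi>^(1/p)\<close>.\<close>
      have i: "integrable lborel (\<lambda>z. \<bar>d z\<bar> * \<phi> z powr (1/p))"
        unfolding d_def by (rule integrable_poly_bump_powr[OF rd less_imp_le[OF pos] le1 _ p]) simp
      show "integrable lborel (\<lambda>x. \<bar>h x\<bar> *\<^sub>R \<bar>\<phi> x\<bar> powr (1 + 1/p))"
      proof (rule Bochner_Integration.integrable_bound[OF i])
        show "AE x in lborel. norm (\<bar>h x\<bar> *\<^sub>R \<bar>\<phi> x\<bar> powr (1 + 1/p)) \<le> norm (\<bar>d x\<bar> * \<phi> x powr (1/p))"
        proof (rule AE_I2)
          fix x
          have "\<bar>h x\<bar> *\<^sub>R \<bar>\<phi> x\<bar> powr (1 + 1/p) = (\<bar>h x\<bar> * \<phi> x) * \<phi> x powr (1/p)"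
            using pos[of x] by (simp add: powr_add)
          also have "\<dots> = \<bar>sgn x * d x\<bar> * \<phi> x powr (1/p)" by (simp add: hphi)
          finally show "norm (\<bar>h x\<bar> *\<^sub>R \<bar>\<phi> x\<bar> powr (1 + 1/p)) \<le> norm (\<bar>d x\<bar> * \<phi> x powr (1/p))"
            by (simp add: abs_mult sgn_if)
        qed
      qed measurable
    qed auto
  qed fact
  have sig: "signed_integral \<mu> A \<phi> = (LINT z:A|lborel. sgn z * d z)"
    if [measurable]: "A \<in> sets borel" and A: "A \<subseteq> {x..y}" for A x y
  proof -
    have "set_integrable lborel A d"
      by (rule set_integrable_subset[OF loc[of "{x..y}"]]) (use A in auto)
    then have i: "integrable lborel (\<lambda>z. indicator A z * d z)" by (simp add: set_integrable_def)
    \<comment> \<open>The cases \<open>u = 1\<close> and \<open>u = -1\<close> are the two Jordan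
      parts.\<close>
    have i': "integrable lborel (\<lambda>z. max 0 (u * h z) * (indicator A z * \<phi> z))" if u: "\<bar>u\<bar> = 1" for u
    proof (rule Bochner_Integration.integrable_bound[OF i])
      show "AE z in lborel. norm (max 0 (u * h z) * (indicator A z * \<phi> z)) \<le> norm (indicator A z * d z)"
      proof (rule AE_I2)
        fix z
        have "max 0 (u * h z) * \<phi> z \<le> \<bar>u * h z\<bar> * \<phi> z"
          using pos[of z] by (intro mult_right_mono) auto
        also have "\<dots> = \<bar>sgn z * d z\<bar>" using u unfolding hphi[symmetric] by (simp add: abs_mult)
        also have "\<dots> \<le> \<bar>d z\<bar>" by (simp add: abs_mult sgn_if)
        finally show "norm (max 0 (u * h z) * (indicator A z * \<phi> z)) \<le> norm (indicator A z * d z)"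
          using pos[of z] by (simp add: indicator_def)
      qed
    qed measurable
    \<comment> \<open>The integral formula for densities asks for a nonnegative real density, so the
      truncation hidden in \<open>ennreal\<close> is written as \<open>max 0\<close>.\<close>
    have e: "(\<integral>z. indicator A z * \<phi> z \<partial>density lborel (\<lambda>z. ennreal (f z)))
        = (\<integral>z. max 0 (f z) * (indicator A z * \<phi> z) \<partial>lborel)"
      if [measurable]: "f \<in> borel_measurable borel" for f :: "real \<Rightarrow> real"
    proof -
      have "(\<lambda>z. ennreal (f z)) = (\<lambda>z. ennreal (max 0 (f z)))"
        by (rule ext) (auto simp: max_def ennreal_neg)
      then have "(\<integral>z. indicator A z * \<phi> z \<partial>density lborel (\<lambda>z. ennreal (f z)))
          = (\<integral>z. indicator A z * \<phi> z \<partial>density lborel (\<lambda>z. ennreal (max 0 (f z))))"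
        by (rule arg_cong)
      also have "\<dots> = (\<integral>z. max 0 (f z) *\<^sub>R (indicator A z * \<phi> z) \<partial>lborel)"
        by (rule integral_density) auto
      finally show ?thesis by simp
    qed
    have "signed_integral \<mu> A \<phi> = (\<integral>z. max 0 (1 * h z) * (indicator A z * \<phi> z) \<partial>lborel)
        - (\<integral>z. max 0 (-1 * h z) * (indicator A z * \<phi> z) \<partial>lborel)"
      unfolding signed_integral_def set_lebesgue_integral_def \<mu>_def fst_conv snd_conv
      using e[of h] e[of "\<lambda>z. - h z"] by simp
    also have "\<dots> = (\<integral>z. max 0 (1 * h z) * (indicator A z * \<phi> z) - max 0 (-1 * h z) * (indicator A z * \<phi> z) \<partial>lborel)"
      by (rule Bochner_Integration.integral_diff[symmetric]; rule i') auto
    also have "\<dots> = (\<integral>z. indicator A z * (sgn z * d z) \<partial>lborel)"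
    proof (rule Bochner_Integration.integral_cong[OF refl])
      fix z
      have "max 0 (1 * h z) * (indicator A z * \<phi> z) - max 0 (-1 * h z) * (indicator A z * \<phi> z)
          = indicator A z * (h z * \<phi> z)"
        by (simp add: max_def algebra_simps)
      also have "h z * \<phi> z = sgn z * d z" using pos[of z] by (simp add: h_def)
      finally show "max 0 (1 * h z) * (indicator A z * \<phi> z) - max 0 (-1 * h z) * (indicator A z * \<phi> z)
          = indicator A z * (sgn z * d z)" .
    qed
    finally show ?thesis by (simp add: set_lebesgue_integral_def)
  qed
  have FTC: "(LINT z:{x..y}|lborel. d z) = poly q y - poly q x" if "x \<le> y" for x y
    unfolding set_lebesgue_integral_def d_def real_scaleR_def mult.commute[of "indicator _ _"]
    by (rule integral_FTC_Icc_real) (use that in \<open>auto intro!: poly_DERIV continuous_intros\<close>)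
  have g: "g_part \<phi> \<mu> x = poly q x - poly q 0" for x
  proof (cases "0 \<le> x")
    case True
    have "g_part \<phi> \<mu> x = (LINT z:{0<..x}|lborel. sgn z * d z)"
      using True sig[of "{0<..x}" 0 x] by (auto simp: g_part_def subset_iff)
    also have "\<dots> = (LINT z:{0<..x}|lborel. d z)"
      by (intro set_lebesgue_integral_cong) auto
    also have "\<dots> = (LINT z:{0..x}|lborel. d z)"
      unfolding set_lebesgue_integral_def
    proof (rule integral_cong_AE)
      show "AE z in lborel. indicator {0<..x} z *\<^sub>R d z = indicator {0..x} z *\<^sub>R d z"
        using AE_lborel_singleton[of 0] by eventually_elim (auto simp: indicator_def)
    qed auto
    finally show ?thesis using FTC[OF True] by simp
  next
    case False
    have "g_part \<phi> \<mu> x = (LINT z:{x<..0}|lborel. sgn z * d z)"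
      using False sig[of "{x<..0}" x 0] by (auto simp: g_part_def subset_iff)
    \<comment> \<open>On the negative half line the sign is -1, up to the null set of the two
      endpoints; integrating \<open>- d\<close> from \<open>x\<close> to 0 gives
      \<open>poly q x - poly q 0\<close>, as on the positive side.\<close>
    also have "\<dots> = (LINT z:{x..0}|lborel. - d z)"
      unfolding set_lebesgue_integral_def
    proof (rule integral_cong_AE)
      show "AE z in lborel. indicator {x<..0} z *\<^sub>R (sgn z * d z) = indicator {x..0} z *\<^sub>R (- d z)"
        using AE_lborel_singleton[of 0] AE_lborel_singleton[of x]
        by eventually_elim (auto simp: indicator_def)
    qed auto
    also have "\<dots> = - (LINT z:{x..0}|lborel. d z)"
      by (simp add: set_lebesgue_integral_def)
    finally show ?thesis using FTC[of x 0] False by simp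
  qed
  \<comment> \<open>There are no atoms: all coefficients are 0, and \<open>real\<close> merely
    serves as an injective enumeration.\<close>
  have "decomposition p \<phi> (poly q) (poly q 0) \<mu> real (\<lambda>_. 0)"
    using \<open>\<mu> \<in> M_class p \<phi>\<close> g by (simp add: decomposition_def inj_of_nat Delta_part_def)
  then show ?thesis unfolding G_class_def by blast
qed

subsection \<open>Rates of the Euler and Milstein schemes\<close>

theorem corollary6p6:
  fixes M :: "'a measure" and W X :: "real \<Rightarrow> 'a \<Rightarrow> real"
    and \<sigma> b :: "real \<Rightarrow> real \<Rightarrow> real" and f :: "real \<Rightarrow> real"
    and T C\<^sub>T \<alpha> x0 p :: real
  assumes "0 < T"
    and "prob_space M" and "complete_measure M"
    and "brownian_motion_on M T W"
    and "1/2 \<le> \<alpha>"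
    and "admissible_coeff T C\<^sub>T \<alpha> \<sigma>" and "admissible_coeff T C\<^sub>T \<alpha> b"
    and "strong_solution M T W \<sigma> b x0 X"
    and "distributed M lborel (X T) f" and "\<forall>x. 0 \<le> f x" and "bdd_above (range f)"
    and "1 \<le> p"
  shows
    "(\<forall>C \<epsilon> \<theta> \<psi> \<phi>.
        strong_error_constants M T (X T) (euler_scheme \<sigma> b x0 W) (1/2) C \<longrightarrow>
        0 < \<epsilon> \<longrightarrow> \<epsilon> < 1/2 \<longrightarrow> \<theta> = \<epsilon> / (1 - \<epsilon>) \<longrightarrow>
        bump \<psi> \<longrightarrow> rapidly_decaying \<psi> \<longrightarrow> \<phi> = tail_bump M (X T) C \<theta> \<psi> \<longrightarrow>
        (\<forall>q :: real poly. poly q \<in> G_class p \<phi>) \<and>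
        (\<forall>n \<tau>. time_grid T n \<tau> \<longrightarrow>
           mesh n \<tau> \<le> 1 \<or> (\<forall>r\<ge>1. Lr_norm M r (\<lambda>\<omega>. X T \<omega> - euler_scheme \<sigma> b x0 W \<tau> n \<omega>) \<le> C r) \<longrightarrow>
           (\<forall>g \<in> G_class p \<phi>.
              integrable M (\<lambda>\<omega>. \<bar>g (X T \<omega>) - g (euler_scheme \<sigma> b x0 W \<tau> n \<omega>)\<bar> powr p) \<and>
              (\<integral>\<omega>. \<bar>g (X T \<omega>) - g (euler_scheme \<sigma> b x0 W \<tau> n \<omega>)\<bar> powr p \<partial>M)
                \<le> 3 * 2 powr p * (SUP x. f x) powr (1 - 2 * \<epsilon>) * V_functional p \<phi> g powr p
                   * C (1 / \<theta>) powr (1 - 2 * \<epsilon>) * mesh n \<tau> powr (1/2 - \<epsilon>))))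
     \<and>
     (space_lipschitz T C\<^sub>T (\<lambda>t. deriv (\<sigma> t)) \<longrightarrow> space_lipschitz T C\<^sub>T (\<lambda>t. deriv (b t)) \<longrightarrow>
      (\<forall>C \<epsilon> \<theta> \<psi> \<phi>.
        strong_error_constants M T (X T) (milstein_scheme \<sigma> b x0 W) 1 C \<longrightarrow>
        0 < \<epsilon> \<longrightarrow> \<epsilon> < 1 \<longrightarrow> \<theta> = \<epsilon> / (2 - \<epsilon>) \<longrightarrow>
        bump \<psi> \<longrightarrow> rapidly_decaying \<psi> \<longrightarrow> \<phi> = tail_bump M (X T) C \<theta> \<psi> \<longrightarrow>
        (\<forall>q :: real poly. poly q \<in> G_class p \<phi>) \<and>
        (\<forall>n \<tau>. time_grid T n \<tau> \<longrightarrow>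
           mesh n \<tau> \<le> 1 \<or> (\<forall>r\<ge>1. Lr_norm M r (\<lambda>\<omega>. X T \<omega> - milstein_scheme \<sigma> b x0 W \<tau> n \<omega>) \<le> C r) \<longrightarrow>
           (\<forall>g \<in> G_class p \<phi>.
              integrable M (\<lambda>\<omega>. \<bar>g (X T \<omega>) - g (milstein_scheme \<sigma> b x0 W \<tau> n \<omega>)\<bar> powr p) \<and>
              (\<integral>\<omega>. \<bar>g (X T \<omega>) - g (milstein_scheme \<sigma> b x0 W \<tau> n \<omega>)\<bar> powr p \<partial>M)
                \<le> 3 * 2 powr p * (SUP x. f x) powr (1 - \<epsilon>) * V_functional p \<phi> g powr p
                   * C (1 / \<theta>) powr (1 - \<epsilon>) * mesh n \<tau> powr (1 - \<epsilon>)))))"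
proof -
  interpret prob_space M by fact
  have XT: "X T \<in> borel_measurable M"
    using distributed_measurable[OF \<open>distributed M lborel (X T) f\<close>] by simp
  have Wm: "W t \<in> borel_measurable M" if "t \<in> {0..T}" for t
    using \<open>brownian_motion_on M T W\<close> that by (simp add: brownian_motion_on_def)
  have poly: "poly q \<in> G_class p (tail_bump M (X T) C \<theta> \<psi>)"
    if "0 < \<theta>" "bump \<psi>" "rapidly_decaying \<psi>" for C \<theta> \<psi> and q :: "real poly"
    by (rule poly_in_G_class[OF rapidly_decaying_tail_bump[OF that(1,3)] tail_bump_bounds[OF that(2)]
          borel_measurable_tail_bump[OF that(2,1)] \<open>1 \<le> p\<close>])
  note ad = \<open>admissible_coeff T C\<^sub>T \<alpha> \<sigma>\<close> \<open>admissible_coeff T C\<^sub>T \<alpha> b\<close>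
  note scheme = scheme_error_bound[OF \<open>0 < T\<close> \<open>distributed M lborel (X T) f\<close> \<open>\<forall>x. 0 \<le> f x\<close>
      \<open>bdd_above (range f)\<close>]
  note moments = moments_of_strong_error[OF \<open>0 < T\<close> \<open>brownian_motion_on M T W\<close> XT]
  show ?thesis
  proof (rule conjI; intro allI impI)
    fix C \<epsilon> \<theta> \<psi> \<phi>
    assume sec: "strong_error_constants M T (X T) (euler_scheme \<sigma> b x0 W) (1/2) C"
      and \<epsilon>: "0 < \<epsilon>" "\<epsilon> < 1/2" and \<theta>: "\<theta> = \<epsilon> / (1 - \<epsilon>)"
      and \<psi>: "bump \<psi>" "rapidly_decaying \<psi>" and \<phi>: "\<phi> = tail_bump M (X T) C \<theta> \<psi>"
    have \<theta>01: "0 < \<theta>" "\<theta> < 1" using \<epsilon> by (auto simp: \<theta>)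
    \<comment> \<open>The given \<open>\<theta>\<close> is the solution of this equation, so the
      interpolation exponent is the exponent of the claim.\<close>
    have \<eta>: "1 - 2 * \<epsilon> = (1 - \<theta>) / (1 + \<theta>)" using \<epsilon> by (simp add: \<theta> field_simps)
    have rate: "1/2 * (1 - 2 * \<epsilon>) = 1/2 - \<epsilon>" by (simp add: field_simps)
    \<comment> \<open>The strong error bound enters twice: on the one-step grid for the moments of
      \<open>X T\<close>, and on the grid of the claim for the rate.\<close>
    note bound = scheme[OF euler_scheme_measurable[OF Wm ad _ order_refl]
        moments[OF sec euler_scheme_one_step] sec _ \<theta>01 \<psi>(1) _ _ \<open>1 \<le> p\<close> _ \<eta>, unfolded rate]
    show "(\<forall>q :: real poly. poly q \<in> G_class p \<phi>) \<and>
        (\<forall>n \<tau>. time_grid T n \<tau> \<longrightarrow>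
           mesh n \<tau> \<le> 1 \<or> (\<forall>r\<ge>1. Lr_norm M r (\<lambda>\<omega>. X T \<omega> - euler_scheme \<sigma> b x0 W \<tau> n \<omega>) \<le> C r) \<longrightarrow>
           (\<forall>g \<in> G_class p \<phi>.
              integrable M (\<lambda>\<omega>. \<bar>g (X T \<omega>) - g (euler_scheme \<sigma> b x0 W \<tau> n \<omega>)\<bar> powr p) \<and>
              (\<integral>\<omega>. \<bar>g (X T \<omega>) - g (euler_scheme \<sigma> b x0 W \<tau> n \<omega>)\<bar> powr p \<partial>M)
                \<le> 3 * 2 powr p * (SUP x. f x) powr (1 - 2 * \<epsilon>) * V_functional p \<phi> g powr p
                   * C (1 / \<theta>) powr (1 - 2 * \<epsilon>) * mesh n \<tau> powr (1/2 - \<epsilon>)))"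
      unfolding \<phi> by (intro conjI allI impI ballI poly[OF \<theta>01(1) \<psi>]) (use bound in auto)
  next
    fix C \<epsilon> \<theta> \<psi> \<phi>
    assume sec: "strong_error_constants M T (X T) (milstein_scheme \<sigma> b x0 W) 1 C"
      and \<epsilon>: "0 < \<epsilon>" "\<epsilon> < 1" and \<theta>: "\<theta> = \<epsilon> / (2 - \<epsilon>)"
      and \<psi>: "bump \<psi>" "rapidly_decaying \<psi>" and \<phi>: "\<phi> = tail_bump M (X T) C \<theta> \<psi>"
    have \<theta>01: "0 < \<theta>" "\<theta> < 1" using \<epsilon> by (auto simp: \<theta>)
    have \<eta>: "1 - \<epsilon> = (1 - \<theta>) / (1 + \<theta>)" using \<epsilon> by (simp add: \<theta> field_simps)
    note bound = scheme[OF milstein_scheme_measurable[OF Wm ad _ order_refl]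
        moments[OF sec milstein_scheme_one_step] sec _ \<theta>01 \<psi>(1) _ _ \<open>1 \<le> p\<close> _ \<eta>, unfolded mult_1]
    show "(\<forall>q :: real poly. poly q \<in> G_class p \<phi>) \<and>
        (\<forall>n \<tau>. time_grid T n \<tau> \<longrightarrow>
           mesh n \<tau> \<le> 1 \<or> (\<forall>r\<ge>1. Lr_norm M r (\<lambda>\<omega>. X T \<omega> - milstein_scheme \<sigma> b x0 W \<tau> n \<omega>) \<le> C r) \<longrightarrow>
           (\<forall>g \<in> G_class p \<phi>.
              integrable M (\<lambda>\<omega>. \<bar>g (X T \<omega>) - g (milstein_scheme \<sigma> b x0 W \<tau> n \<omega>)\<bar> powr p) \<and>
              (\<integral>\<omega>. \<bar>g (X T \<omega>) - g (milstein_scheme \<sigma> b x0 W \<tau> n \<omega>)\<bar> powr p \<partial>M)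
                \<le> 3 * 2 powr p * (SUP x. f x) powr (1 - \<epsilon>) * V_functional p \<phi> g powr p
                   * C (1 / \<theta>) powr (1 - \<epsilon>) * mesh n \<tau> powr (1 - \<epsilon>)))"
      unfolding \<phi> by (intro conjI allI impI ballI poly[OF \<theta>01(1) \<psi>]) (use bound in auto)
  qed
qed

end
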